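(* For each nonnegative integer $d$ there exists a $(5d+1)\times(d+1)$ matrix $\mathcal B_d$ with entries in $\mathbb Z$ such that the following holds for every homogeneous polynomial $\sum_{k=0}^{d}a_kA^{5k}(q)B^{5(d-k)}(q)$ of degree $d$ in $A^5(q)$ and $B^5(q)$ with coefficients $a_k\in\mathbb C$. If $$\mathcal B_d\,(a_0,a_1,\ldots,a_d)^T=(b_0,b_1,\ldots,b_{5d})^T,$$ $\chi$ denotes the principal Dirichlet character modulo five, and $0\le m\le4$ is an integer, then $$\pi\Bigl(\sum_{k=0}^{d}a_kA^{5k}(q)B^{5(d-k)}(q)\Bigr)=\sum_{k=0}^{5d}b_kA^{k}(q)B^{5d-k}(q),$$ $$\Omega_{5,m}\Bigl(\sum_{k=0}^{d}a_kA^{5k}(q)B^{5(d-k)}(q)\Bigr)=q^{-m/5}\sum_{k=0}^{d-\chi(m)}b_{5k+m}A^{5k+m}(q)B^{5d-5k-m}(q).$$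
   Context: $q=e^{2\pi i\tau}$ with $\operatorname{Im}\tau>0$, and $q^{r}=e^{2\pi ir\tau}$. $(a;q)_\infty=\prod_{k\ge0}(1-aq^k)$, and fractional powers of $(q;q)_\infty$ are the branches whose power series have constant term $1$. The functions $A$ and $B$ are $$A(q)=q^{1/5}(q;q)_\infty^{-3/5}\sum_{n=-\infty}^{\infty}(-1)^nq^{(5n^2-3n)/2},\qquad B(q)=(q;q)_\infty^{-3/5}\sum_{n=-\infty}^{\infty}(-1)^nq^{(5n^2-n)/2}.$$ (Thus $A^5$ and $B^5$ are power series in $q$.) The operators $\pi$ and $\Omega_{5,m}$ act on power series by $$\pi\Bigl(\sum_{n\ge0}a_nq^n\Bigr)=\sum_{n\ge0}a_nq^{n/5},\qquad \Omega_{5,m}\Bigl(\sum_{n\ge0}a_nq^n\Bigr)=\sum_{n\ge0}a_{5n+m}q^n,\quad m=0,1,2,3,4.$$ The principal character satisfies $\chi(0)=0$ and $\chi(m)=1$ for $m=1,2,3,4$. *)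

theory Defs
  imports "HOL-Complex_Analysis.Complex_Analysis" "Jordan_Normal_Form.Matrix"
begin

definition qpow :: "real \<Rightarrow> complex \<Rightarrow> complex" where
  "qpow r \<tau> = exp (2 * of_real pi * \<i> * of_real r * \<tau>)"

abbreviation nome :: "complex \<Rightarrow> complex" where
  "nome \<tau> \<equiv> qpow 1 \<tau>"

definition qpoch_inf :: "complex \<Rightarrow> complex \<Rightarrow> complex" where
  "qpoch_inf a q = (\<Prod>k. 1 - a * q ^ k)"

text \<open>The branch of \<open>f\<^sup>p\<^sup>/\<^sup>n\<close> on the unit disc whose power series has constant term 1.
  For \<open>f(q) = (q;q)\<^sub>\<infinity>\<close> it exists and is unique on the disc, by the lemmas \<open>unit_branch_euler\<close> and
  \<open>unit_branch_unique\<close> below.\<close>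

definition is_unit_branch ::
    "(complex \<Rightarrow> complex) \<Rightarrow> int \<Rightarrow> nat \<Rightarrow> (complex \<Rightarrow> complex) \<Rightarrow> bool" where
  "is_unit_branch f p n g \<longleftrightarrow>
     g holomorphic_on ball 0 1 \<and> g 0 = 1 \<and> (\<forall>z\<in>ball 0 1. g z ^ n = f z powi p)"

definition unit_branch :: "(complex \<Rightarrow> complex) \<Rightarrow> int \<Rightarrow> nat \<Rightarrow> complex \<Rightarrow> complex" where
  "unit_branch f p n = (SOME g. is_unit_branch f p n g)"

definition euler_pow :: "complex \<Rightarrow> complex" where
  "euler_pow = unit_branch (\<lambda>q. qpoch_inf q q) (-3) 5"

text \<open>\<open>A\<close> and \<open>B\<close> as functions of \<open>\<tau>\<close> in the upper half plane (\<open>A\<close> is not single-valued in \<open>q\<close>).\<close>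

definition fun_A :: "complex \<Rightarrow> complex" where
  "fun_A \<tau> = qpow (1/5) \<tau> * euler_pow (nome \<tau>) *
     (\<Sum>\<^sub>\<infinity>n::int. (-1) powi n * qpow (of_int (5 * n^2 - 3 * n) / 2) \<tau>)"

definition fun_B :: "complex \<Rightarrow> complex" where
  "fun_B \<tau> = euler_pow (nome \<tau>) *
     (\<Sum>\<^sub>\<infinity>n::int. (-1) powi n * qpow (of_int (5 * n^2 - n) / 2) \<tau>)"

text \<open>\<open>F\<close> is the power series in \<open>q\<close> of \<open>f\<close>; it is determined by \<open>f\<close>, see
  \<open>has_q_expansion_unique\<close> below.\<close>

definition has_q_expansion :: "(complex \<Rightarrow> complex) \<Rightarrow> complex fps \<Rightarrow> bool" where
  "has_q_expansion f F \<longleftrightarrow>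
     (\<forall>\<tau>. Im \<tau> > 0 \<longrightarrow> (\<lambda>n. fps_nth F n * nome \<tau> ^ n) sums f \<tau>)"

text \<open>The operator \<open>\<pi>\<close> leaves the ring of power series in \<open>q\<close>, so its value is given directly as a
  function of \<open>\<tau>\<close>.\<close>

definition op_pi :: "complex fps \<Rightarrow> complex \<Rightarrow> complex" where
  "op_pi F \<tau> = (\<Sum>n. fps_nth F n * qpow (real n / 5) \<tau>)"

definition op_Omega5 :: "nat \<Rightarrow> complex fps \<Rightarrow> complex fps" where
  "op_Omega5 m F = Abs_fps (\<lambda>n. fps_nth F (5 * n + m))"

definition principal_char5 :: "nat \<Rightarrow> int" where
  "principal_char5 m = (if 5 dvd m then 0 else 1)"


lemma norm_nome_less_1: "norm (nome \<tau>) < 1" if "Im \<tau> > 0"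
  using that by (simp add: qpow_def)

lemma nome_surj:
  assumes "q \<noteq> 0" "norm q < 1"
  shows "\<exists>\<tau>. Im \<tau> > 0 \<and> nome \<tau> = q"
proof (intro exI conjI)
  let ?\<tau> = "Ln q / (2 * of_real pi * \<i>)"
  have eq: "2 * of_real pi * \<i> * of_real 1 * ?\<tau> = Ln q"
    by simp
  show "nome ?\<tau> = q"
    unfolding qpow_def eq using assms by simp
  have "Im ?\<tau> = - ln (norm q) / (2 * pi)"
    using assms by (simp add: Im_divide power2_eq_square field_simps)
  also have "\<dots> > 0"
    using assms by (simp add: divide_neg_pos ln_less_zero)
  finally show "Im ?\<tau> > 0" .
qed

lemma has_q_expansion_unique:
  assumes F: "has_q_expansion f F" and G: "has_q_expansion f G"
  shows "F = G"
proof -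
  define c where "c n = fps_nth F n - fps_nth G n" for n
  have sums: "(\<lambda>n. c n * q ^ n) sums 0" if q: "q \<noteq> 0" "norm q < 1" for q
  proof -
    obtain \<tau> where "Im \<tau> > 0" "nome \<tau> = q"
      using nome_surj[OF q] by blast
    thus ?thesis
      using F G sums_diff[of "\<lambda>n. fps_nth F n * q ^ n" "f \<tau>" "\<lambda>n. fps_nth G n * q ^ n" "f \<tau>"]
      by (auto simp: has_q_expansion_def c_def algebra_simps)
  qed
  have "c n = 0" for n
  proof (induction n rule: less_induct)
    case (less n)
    have shifted: "(\<lambda>k. c (k + n) * q ^ k) sums 0" if q: "q \<noteq> 0" "norm q < 1" for q
    proof -
      have "(\<lambda>k. c (k + n) * q ^ (k + n)) sums 0"
        using sums_split_initial_segment[OF sums[OF q], of n] less.IH by simp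
      hence "(\<lambda>k. c (k + n) * q ^ (k + n) / q ^ n) sums (0 / q ^ n)"
        by (rule sums_divide)
      thus ?thesis using q by (simp add: power_add)
    qed
    have "((\<lambda>_. 0) \<longlongrightarrow> c (0 + n)) (at (0::complex))"
      by (rule powser_limit_0_strong[of 1 "\<lambda>k. c (k + n)"]) (use shifted in auto)
    thus ?case
      by (simp add: tendsto_const_iff)
  qed
  thus ?thesis
    by (simp add: c_def fps_eq_iff)
qed

lemma unit_branch_unique:
  assumes g: "is_unit_branch f p n g" and h: "is_unit_branch f p n h"
    and n: "n > 0" and f: "\<And>z. z \<in> ball 0 1 \<Longrightarrow> f z \<noteq> 0" and z: "z \<in> ball 0 1"
  shows "g z = h z"
proof -
  have nz: "h w \<noteq> 0" if "w \<in> ball 0 1" for w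
    using h f[OF that] that n unfolding is_unit_branch_def
    by (metis power_int_eq_0_iff zero_power)
  define r where "r w = g w / h w" for w
  have "r constant_on ball 0 1"
  proof (rule continuous_finite_range_constant)
    have "r holomorphic_on ball 0 1"
      unfolding r_def using g h nz by (auto simp: is_unit_branch_def intro!: holomorphic_intros)
    thus "continuous_on (ball 0 1) r"
      by (rule holomorphic_on_imp_continuous_on)
    have "r w ^ n = 1" if "w \<in> ball 0 1" for w
      using g h that nz[OF that] unfolding is_unit_branch_def r_def
      by (metis divide_self_if power_divide power_not_zero)
    hence "r ` ball 0 1 \<subseteq> {w. w ^ n = 1}" by auto
    thus "finite (r ` ball 0 1)"
      using finite_roots_unity[of n] n by (auto intro: finite_subset)
  qed auto
  moreover have "r 0 = 1"
    using g h by (simp add: r_def is_unit_branch_def)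
  ultimately have "r z = 1"
    using z unfolding constant_on_def by (force dest: bspec[where x = 0])
  thus ?thesis using nz[OF z] by (simp add: r_def)
qed

lemma euler_convergent:
  assumes "norm (q::complex) < 1"
  shows "convergent_prod (\<lambda>k. 1 - q * q ^ k)"
proof -
  have "summable (\<lambda>k. norm q * norm q ^ k)"
    using assms by (intro summable_mult summable_geometric) auto
  hence "abs_convergent_prod (\<lambda>k. 1 - q * q ^ k)"
    by (intro summable_imp_abs_convergent_prod) (simp add: norm_mult norm_power)
  thus ?thesis by (rule abs_convergent_prod_imp_convergent_prod)
qed

lemma euler_factor_nonzero:
  assumes "norm (q::complex) < 1"
  shows "1 - q * q ^ k \<noteq> 0"
proof -
  have "norm (q * q ^ k) < 1"
    using assms power_Suc_less_one[of "norm q" k] power_less_one_iff[of "norm q" "Suc k"]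
    by (simp add: norm_mult norm_power)
  thus ?thesis
    by (metis eq_iff_diff_eq_0 norm_one less_irrefl)
qed

lemma euler_nonzero:
  assumes "norm (q::complex) < 1"
  shows "qpoch_inf q q \<noteq> 0"
  unfolding qpoch_inf_def
  by (rule prodinf_nonzero[OF euler_convergent[OF assms] euler_factor_nonzero[OF assms]])

lemma euler_holomorphic: "(\<lambda>q. qpoch_inf q q) holomorphic_on ball 0 1"
proof (rule holomorphic_uniform_sequence)
  fix n :: nat
  show "(\<lambda>q. \<Prod>k<n. 1 - q * q ^ k) holomorphic_on ball 0 (1::real)"
    by (intro holomorphic_intros)
next
  fix x :: complex assume x: "x \<in> ball 0 1"
  define d where "d = (1 - norm x) / 2"
  have d: "d > 0" "norm x + d < 1" using x by (auto simp: d_def field_simps)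
  have sub: "norm y \<le> norm x + d" if "y \<in> cball x d" for y
    using that norm_triangle_ineq[of x "y - x"] by (auto simp: dist_norm norm_minus_commute)
  have "uniformly_convergent_on (cball x d) (\<lambda>N q. \<Prod>k<N. 1 + (- q * q ^ k))"
  proof (rule Infinite_Products.uniformly_convergent_on_prod)
    show "uniformly_convergent_on (cball x d) (\<lambda>N q. \<Sum>k<N. norm (- (q::complex) * q ^ k))"
    proof (rule Weierstrass_m_test'[where M = "\<lambda>k. (norm x + d) ^ Suc k"])
      show "summable (\<lambda>k. (norm x + d) ^ Suc k)"
        using d by (subst summable_Suc_iff) (auto intro!: summable_geometric)
    next
      fix k q assume q: "q \<in> cball x d"
      have "norm q ^ Suc k \<le> (norm x + d) ^ Suc k"
        by (rule power_mono[OF sub[OF q]]) simp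
      thus "norm (norm (- q * q ^ k)) \<le> (norm x + d) ^ Suc k"
        by (simp add: norm_mult norm_power)
    qed
  qed (auto intro!: continuous_intros)
  hence "uniform_limit (cball x d) (\<lambda>N q. \<Prod>k<N. 1 - q * q ^ k)
           (\<lambda>q. lim (\<lambda>N. \<Prod>k<N. 1 - q * q ^ k)) sequentially"
    by (simp add: uniformly_convergent_uniform_limit_iff)
  moreover have "lim (\<lambda>N. \<Prod>k<N. 1 - q * q ^ k) = qpoch_inf q q" if "q \<in> cball x d" for q
  proof -
    have q: "norm q < 1" using sub[OF that] d by simp
    show ?thesis unfolding qpoch_inf_def
      by (rule prodinf_eq_lim'[OF euler_convergent[OF q] euler_factor_nonzero[OF q], symmetric])
  qed
  ultimately have "uniform_limit (cball x d) (\<lambda>N q. \<Prod>k<N. 1 - q * q ^ k)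
                     (\<lambda>q. qpoch_inf q q) sequentially"
    using uniform_limit_cong'[of "cball x d"] by (smt (verit, best))
  moreover have "cball x d \<subseteq> ball 0 1" using sub d by fastforce
  ultimately show "\<exists>d>0. cball x d \<subseteq> ball 0 1 \<and>
      uniform_limit (cball x d) (\<lambda>N q. \<Prod>k<N. 1 - q * q ^ k) (\<lambda>q. qpoch_inf q q) sequentially"
    using d by blast
qed auto

lemma unit_branch_euler:
  assumes "n > 0"
  shows "is_unit_branch (\<lambda>q. qpoch_inf q q) p n (unit_branch (\<lambda>q. qpoch_inf q q) p n)"
proof -
  obtain L where L: "L holomorphic_on ball 0 1"
      "\<And>z. z \<in> ball 0 1 \<Longrightarrow> qpoch_inf z z = exp (L z)"
    using contractible_imp_holomorphic_log[OF euler_holomorphic]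
          euler_nonzero convex_imp_contractible[of "ball 0 1"] by (metis convex_ball mem_ball_0)
  define g where "g z = exp (of_int p * (L z - L 0) / of_nat n)" for z
  have L0: "exp (L 0) = 1"
    using L(2)[of 0] by (simp add: qpoch_inf_def)
  have pow: "g z ^ n = qpoch_inf z z powi p" if "z \<in> ball 0 1" for z
  proof -
    have "g z ^ n = exp (of_nat n * (of_int p * (L z - L 0) / of_nat n))"
      unfolding g_def by (rule exp_of_nat_mult[symmetric])
    also have "of_nat n * (of_int p * (L z - L 0) / of_nat n) = of_int p * (L z - L 0)"
      using assms by simp
    also have "exp \<dots> = exp (L z - L 0) powi p"
      by (rule exp_power_int[symmetric])
    also have "exp (L z - L 0) = qpoch_inf z z"
      using L(2)[OF that] L0 by (simp add: exp_diff)
    finally show ?thesis .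
  qed
  have "g holomorphic_on ball 0 1"
    unfolding g_def using assms L(1) by (auto intro!: holomorphic_intros)
  hence "is_unit_branch (\<lambda>q. qpoch_inf q q) p n g"
    using pow by (simp add: is_unit_branch_def g_def)
  thus ?thesis unfolding unit_branch_def by (rule someI[where P = "is_unit_branch _ _ _"])
qed

end

theory Submission
  imports Defs
begin

text \<open>Write \<open>\<theta>\<^sub>A\<close>, \<open>\<theta>\<^sub>B\<close> for the two theta series in \<open>A\<close> and \<open>B\<close>, \<open>E(q) = (q;q)\<^sub>\<infinity>\<close>, and let \<open>\<zeta>\<close> be a
  primitive fifth root of unity. Everything rests on expressing \<open>A\<^sup>5(q)\<close> and \<open>B\<^sup>5(q)\<close> as integral forms
  of degree 5 in \<open>A(q\<^sup>5)\<close> and \<open>B(q\<^sup>5)\<close>. Splitting the summation index of the theta series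
  \<open>\<Sum> (-1)\<^sup>n q^(n(n-1)/2) z^n\<close> modulo 5 at \<open>z = \<zeta>\<^sup>j\<close> shows that the product
  \<open>\<Prod> (1 - q\<^sup>n)(1 - z q\<^sup>n)(1 - q\<^sup>n/z)\<close> equals the linear form
  \<open>\<theta>\<^sub>B(q\<^sup>5) + (z\<^sup>2 + z\<^sup>3) q \<theta>\<^sub>A(q\<^sup>5)\<close>. Replace \<open>q\<close> by \<open>\<zeta>\<^sup>j q\<close>, take \<open>z = \<zeta>^(cj)\<close> and multiply over
  \<open>j = 1, \<dots>, 4\<close>: the linear forms give an integral quartic form, while the factors of the infinite
  products recombine to \<open>\<theta>\<^sub>A(q)\<^sup>5 E(q\<^sup>5)\<^sup>3 / (E(q)\<^sup>3 \<theta>\<^sub>A(q\<^sup>5))\<close> for \<open>c = 1\<close> and to the analogous quotient with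
  \<open>\<theta>\<^sub>B\<close> for \<open>c = 2\<close>. The entries of the matrix are the coefficients of the resulting forms, and since
  \<open>A^k B^(5d-k)\<close> is \<open>q^(k/5)\<close> times a power series in \<open>q\<close>, sorting by \<open>k\<close> modulo 5 yields the operators
  \<open>\<Omega>\<close>.\<close>

section \<open>Gaussian binomial coefficients and theta series\<close>

text \<open>The Gaussian binomial coefficient. The q-Pascal rule gives it as a polynomial in
  \<open>q\<close>, meaningful even where a quotient of q-factorials would have denominator
  0.\<close>

fun qbinomial :: "'a::comm_ring_1 \<Rightarrow> nat \<Rightarrow> nat \<Rightarrow> 'a" where
  "qbinomial q n 0 = 1"
| "qbinomial q 0 (Suc k) = 0"
| "qbinomial q (Suc n) (Suc k) = qbinomial q n k + q ^ Suc k * qbinomial q n (Suc k)"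

lemma qbinomial_eq_0: "n < k \<Longrightarrow> qbinomial q n k = 0"
  by (induction q n k rule: qbinomial.induct) auto

lemma triangle_Suc: "Suc k * (Suc k - 1) div 2 = k * (k - 1) div 2 + k"
proof -
  have "Suc k * (Suc k - 1) = k * (k - 1) + k * 2"
    by (cases k) auto
  thus ?thesis by simp
qed

text \<open>Splitting off the factor \<open>1 + x\<close> leaves the product for
  \<open>x * q\<close>, hence the induction over arbitrary \<open>x\<close>; collecting powers of
  \<open>x\<close> then reproduces the q-Pascal rule.\<close>

lemma qbinomial_theorem:
  fixes x q :: "'a::comm_ring_1"
  shows "(\<Prod>k<n. 1 + x * q ^ k) = (\<Sum>k\<le>n. qbinomial q n k * q ^ (k * (k - 1) div 2) * x ^ k)"
proof (induction n arbitrary: x)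
  case 0
  show ?case by simp
next
  case (Suc n)
  define g where "g k = qbinomial q n k * q ^ (k * (k - 1) div 2) * (x * q) ^ k" for k
  have g0: "g 0 = 1" and g_last: "g (Suc n) = 0"
    by (simp_all add: g_def qbinomial_eq_0)
  have T: "q ^ (Suc k * (Suc k - 1) div 2) = q ^ (k * (k - 1) div 2) * q ^ k" for k
    by (simp only: triangle_Suc power_add)
  have "(\<Prod>k<Suc n. 1 + x * q ^ k) = (1 + x) * (\<Prod>k<n. 1 + (x * q) * q ^ k)"
    by (subst prod.lessThan_Suc_shift) (simp add: mult.assoc)
  also have "\<dots> = (1 + x) * (\<Sum>k\<le>n. g k)"
    by (simp only: Suc.IH g_def)
  also have "\<dots> = (\<Sum>k\<le>Suc n. g k) + (\<Sum>k\<le>n. x * g k)"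
    by (simp add: g_last distrib_right sum_distrib_left sum.distrib)
  also have "\<dots> = 1 + (\<Sum>k\<le>n. g (Suc k) + x * g k)"
    by (subst sum.atMost_Suc_shift) (simp add: g0 sum.distrib)
  also have "\<dots> = 1 + (\<Sum>k\<le>n. qbinomial q (Suc n) (Suc k) *
                       q ^ (Suc k * (Suc k - 1) div 2) * x ^ Suc k)"
    unfolding g_def T by (intro arg_cong2[of _ _ _ _ "(+)"] sum.cong refl)
      (simp add: distrib_left distrib_right power_mult_distrib mult_ac)
  also have "\<dots> = (\<Sum>k\<le>Suc n. qbinomial q (Suc n) k * q ^ (k * (k - 1) div 2) * x ^ k)"
    by (subst sum.atMost_Suc_shift) simp
  finally show ?case .
qed

definition qfact :: "'a::comm_ring_1 \<Rightarrow> nat \<Rightarrow> 'a" where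
  "qfact q n = (\<Prod>k<n. 1 - q ^ Suc k)"

text \<open>With denominators cleared, the quotient formula makes sense in every commutative ring.
  It later turns the coefficients of the finite triple product into quotients of convergent
  sequences.\<close>

lemma qbinomial_qfact:
  "k \<le> n \<Longrightarrow> qbinomial q n k * (qfact q k * qfact q (n - k)) = qfact q n"
proof (induction n arbitrary: k)
  case 0
  thus ?case by (simp add: qfact_def)
next
  case (Suc n)
  show ?case
  proof (cases k)
    case 0
    thus ?thesis by (simp add: qfact_def)
  next
    case (Suc j)
    hence j: "j \<le> n" using Suc.prems by simp
    have f_Suc: "qfact q (Suc i) = qfact q i * (1 - q ^ Suc i)" for i
      by (simp add: qfact_def)
    have 1: "qbinomial q n j * (qfact q j * qfact q (n - j)) = qfact q n"
      by (rule Suc.IH[OF j])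
    \<comment> \<open>For \<open>j = n\<close> both sides vanish: the binomial coefficient on the
      left and \<open>1 - q ^ 0\<close> on the right.\<close>
    have 2: "qbinomial q n (Suc j) * (qfact q (Suc j) * qfact q (n - j)) = qfact q n * (1 - q ^ (n - j))"
    proof (cases "j = n")
      case True
      thus ?thesis by (simp add: qbinomial_eq_0)
    next
      case False
      hence e: "n - j = Suc (n - Suc j)" and le: "Suc j \<le> n" using j by auto
      show ?thesis
        using Suc.IH[OF le] unfolding e f_Suc[of "n - Suc j"] by (metis mult.assoc)
    qed
    have 3: "q ^ Suc j * q ^ (n - j) = q ^ Suc n"
      by (simp only: power_add[symmetric]) (use j in simp)
    have expand: "(a + r * b) * (f * (1 - r) * g) = a * (f * g) * (1 - r) + r * (b * (f * (1 - r) * g))"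
      for a b f g r :: 'a
      by (simp add: algebra_simps)
    have collect: "f * (1 - r) + r * (f * (1 - s)) = f * (1 - r * s)" for f r s :: 'a
      by (simp add: algebra_simps)
    have "qbinomial q (Suc n) k * (qfact q k * qfact q (Suc n - k)) =
          qbinomial q n j * (qfact q j * qfact q (n - j)) * (1 - q ^ Suc j) +
          q ^ Suc j * (qbinomial q n (Suc j) * (qfact q (Suc j) * qfact q (n - j)))"
      unfolding Suc qbinomial.simps f_Suc[of j] diff_Suc_Suc by (rule expand)
    also have "\<dots> = qfact q n * (1 - q ^ Suc j * q ^ (n - j))"
      unfolding 1 2 by (rule collect)
    also have "\<dots> = qfact q (Suc n)"
      unfolding 3 by (simp add: f_Suc)
    finally show ?thesis .
  qed
qed

section \<open>Sums over the integers and convergence of theta series\<close>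

lemma summable_int_decode:
  fixes M :: "int \<Rightarrow> real"
  assumes "M summable_on UNIV"
  shows "summable (\<lambda>k. M (int_decode k))"
proof -
  have "(\<lambda>k. M (int_decode k)) summable_on UNIV"
    using assms summable_on_reindex_bij_betw[OF bij_int_decode, of M] by simp
  then obtain s where "((\<lambda>k. M (int_decode k)) has_sum s) UNIV"
    by (auto simp: summable_on_def)
  thus ?thesis
    by (rule sums_summable[OF has_sum_imp_sums])
qed

text \<open>The majorant \<open>M\<close> makes the sum absolutely convergent, so it may be taken
  along the enumeration \<open>int_decode\<close>. This opens sums over the integers to Tannery's
  theorem and the Weierstrass M-test.\<close>

lemma infsum_int_eq_suminf:
  fixes f :: "int \<Rightarrow> complex"
  assumes M: "M summable_on UNIV" and bound: "\<And>n. norm (f n) \<le> M n"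
  shows "(\<Sum>\<^sub>\<infinity>n. f n) = (\<Sum>k. f (int_decode k))"
proof -
  have S: "summable (\<lambda>k. norm (f (int_decode k)))"
    by (rule summable_comparison_test'[OF summable_int_decode[OF M], of 0]) (simp add: bound)
  have "((\<lambda>k. f (int_decode k)) has_sum (\<Sum>k. f (int_decode k))) UNIV"
    by (rule norm_summable_imp_has_sum[OF S summable_sums[OF summable_norm_cancel[OF S]]])
  hence "(\<Sum>\<^sub>\<infinity>k. f (int_decode k)) = (\<Sum>k. f (int_decode k))"
    by (rule infsumI)
  thus ?thesis
    by (simp only: infsum_reindex_bij_betw[OF bij_int_decode])
qed

lemma tannery_int:
  fixes a :: "nat \<Rightarrow> int \<Rightarrow> complex"
  assumes lim: "\<And>n. (\<lambda>N. a N n) \<longlonglongrightarrow> b n"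
    and bound: "\<And>N n. norm (a N n) \<le> M n"
    and M: "M summable_on UNIV"
  shows "(\<lambda>N. \<Sum>\<^sub>\<infinity>n. a N n) \<longlonglongrightarrow> (\<Sum>\<^sub>\<infinity>n. b n)"
proof -
  have b: "norm (b n) \<le> M n" for n
    by (rule Lim_norm_ubound[OF trivial_limit_sequentially lim]) (simp add: bound)
  have "(\<lambda>N. \<Sum>k. a N (int_decode k)) \<longlonglongrightarrow> (\<Sum>k. b (int_decode k))"
  proof (rule conjunct2[OF conjunct2[OF tannerys_theorem]])
    show "\<forall>\<^sub>F (k, N) in sequentially \<times>\<^sub>F sequentially. norm (a N (int_decode k)) \<le> M (int_decode k)"
      by (rule always_eventually) (simp add: bound split: prod.split)
  qed (rule lim summable_int_decode[OF M] trivial_limit_sequentially)+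
  thus ?thesis
    by (simp only: infsum_int_eq_suminf[OF M bound] infsum_int_eq_suminf[OF M b])
qed

text \<open>Consecutive terms have ratio \<open>r ^ n * y\<close>, which tends to 0 however large
  \<open>y\<close> is.\<close>

lemma summable_theta_nat:
  fixes r y :: real
  assumes "0 \<le> r" "r < 1" "0 \<le> y"
  shows "summable (\<lambda>n. r ^ (n * (n - 1) div 2) * y ^ n)"
proof -
  have "(\<lambda>n. r ^ n * y) \<longlonglongrightarrow> 0 * y"
    by (intro tendsto_intros LIMSEQ_realpow_zero) (use assms in auto)
  hence "eventually (\<lambda>n. r ^ n * y < 1/2) sequentially"
    by (rule order_tendstoD) simp
  then obtain N where N: "\<And>n. n \<ge> N \<Longrightarrow> r ^ n * y < 1/2"
    by (auto simp: eventually_sequentially)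
  show ?thesis
  proof (rule summable_ratio_test[of "1/2" N])
    fix n assume "N \<le> n"
    have "r ^ (Suc n * (Suc n - 1) div 2) * y ^ Suc n
          = (r ^ n * y) * (r ^ (n * (n - 1) div 2) * y ^ n)"
      unfolding triangle_Suc by (simp add: power_add)
    also have "\<dots> \<le> 1/2 * (r ^ (n * (n - 1) div 2) * y ^ n)"
      by (intro mult_right_mono) (use N[OF \<open>N \<le> n\<close>] assms in auto)
    finally show "norm (r ^ (Suc n * (Suc n - 1) div 2) * y ^ Suc n)
                  \<le> 1/2 * norm (r ^ (n * (n - 1) div 2) * y ^ n)"
      using assms by simp
  qed simp
qed

text \<open>At the index \<open>- n\<close> the triangular number is n(n-1)/2 + n, so the negative
  half is a one-sided series with \<open>r / y\<close> in place of \<open>y\<close>.\<close>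

lemma summable_theta_int:
  fixes r y :: real
  assumes "0 \<le> r" "r < 1" "0 < y"
  shows "(\<lambda>n::int. r ^ nat (n * (n - 1) div 2) * y powi n) summable_on UNIV"
proof -
  let ?f = "\<lambda>n::int. r ^ nat (n * (n - 1) div 2) * y powi n"
  have nats: "g summable_on UNIV" if "summable g" "\<And>n. g n \<ge> 0" for g :: "nat \<Rightarrow> real"
    using that by (intro norm_summable_imp_summable_on) simp
  have "?f summable_on range int"
  proof (subst summable_on_reindex)
    have "nat (int n * (int n - 1) div 2) = n * (n - 1) div 2" for n
    proof -
      have "int n * (int n - 1) = int (n * (n - 1))"
        by (cases n) (simp_all add: algebra_simps)
      thus ?thesis by (metis nat_int of_nat_numeral zdiv_int)
    qed
    thus "(?f \<circ> int) summable_on UNIV"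
      using summable_theta_nat[of r y] assms by (auto simp: o_def intro!: nats)
  qed simp
  moreover have "?f summable_on range (\<lambda>n. - int n)"
  proof (subst summable_on_reindex)
    have "nat (- int n * (- int n - 1) div 2) = n * (n - 1) div 2 + n" for n
    proof -
      have "- int n * (- int n - 1) = int (n * (n - 1) + 2 * n)"
        by (cases n) (auto simp: algebra_simps)
      hence "nat (- int n * (- int n - 1) div 2) = (n * (n - 1) + 2 * n) div 2"
        by (metis nat_int of_nat_numeral zdiv_int)
      thus ?thesis by simp
    qed
    hence "?f (- int n) = r ^ (n * (n - 1) div 2) * (r / y) ^ n" for n
      by (simp add: power_add power_divide power_int_minus divide_simps)
    thus "(?f \<circ> (\<lambda>n. - int n)) summable_on UNIV"
      using summable_theta_nat[of r "r / y"] assms by (auto simp: o_def intro!: nats)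
  qed (auto simp: inj_on_def)
  \<comment> \<open>The index 0 lies in both ranges; the set difference makes the union
    disjoint.\<close>
  ultimately have "?f summable_on (range int \<union> (range (\<lambda>n. - int n) - range int))"
    by (intro summable_on_Un_disjoint) (auto intro: summable_on_subset)
  moreover have "range int \<union> (range (\<lambda>n. - int n) - range int) = UNIV"
  proof -
    have "n \<in> range int \<or> n \<in> range (\<lambda>n. - int n)" for n
      by (cases n rule: int_cases2) auto
    thus ?thesis by blast
  qed
  ultimately show ?thesis by simp
qed

section \<open>The Jacobi triple product\<close>

text \<open>The number n(n-1)/2 is never negative, so \<open>nat\<close> does not truncate
  it.\<close>

definition theta_term :: "complex \<Rightarrow> complex \<Rightarrow> int \<Rightarrow> complex" where
  "theta_term q z n = (-1) powi n * q ^ nat (n * (n - 1) div 2) * z powi n"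

definition jacobi_theta :: "complex \<Rightarrow> complex \<Rightarrow> complex" where
  "jacobi_theta q z = (\<Sum>\<^sub>\<infinity>n. theta_term q z n)"

lemma norm_theta_term:
  "norm (theta_term q z n) = norm q ^ nat (n * (n - 1) div 2) * norm z powi n"
  by (simp add: theta_term_def norm_mult norm_power norm_power_int)

text \<open>Exponent bookkeeping for recentring the q-binomial sum over \<open>j \<le> 2 * N\<close>
  at \<open>N\<close>: the triangular number of j - N produces the cross term
  \<open>N * j\<close>.\<close>

lemma triangle_shift:
  "nat ((int j - int N) * (int j - int N - 1) div 2) + N * j = j * (j - 1) div 2 + N * (N + 1) div 2"
proof -
  define m where "m = int j - int N"
  have "even (m * (m - 1))" by simp
  hence 1: "2 * (m * (m - 1) div 2) = m * (m - 1)" by simp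
  have "0 \<le> m * (m - 1)"
    by (cases "m \<le> 0") (auto simp: mult_nonpos_nonpos)
  hence "0 \<le> m * (m - 1) div 2" by simp
  hence 2: "2 * int (nat (m * (m - 1) div 2)) = m * (m - 1)"
    using 1 by simp
  have 3: "2 * int (j * (j - 1) div 2) = int j * (int j - 1)"
  proof -
    have "2 * (j * (j - 1) div 2) = j * (j - 1)"
      by (cases j) auto
    moreover have "int (j * (j - 1)) = int j * (int j - 1)"
      by (cases j) (simp_all add: algebra_simps)
    ultimately show ?thesis by (metis of_nat_mult of_nat_numeral)
  qed
  have 4: "2 * int (N * (N + 1) div 2) = int N * (int N + 1)"
  proof -
    have "2 * (N * (N + 1) div 2) = N * (N + 1)"
      by (rule dvd_mult_div_cancel) simp
    hence "int (2 * (N * (N + 1) div 2)) = int (N * (N + 1))"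
      by (simp only:)
    thus ?thesis by (simp only: of_nat_mult of_nat_numeral of_nat_add of_nat_1)
  qed
  have "2 * int (nat (m * (m - 1) div 2) + N * j) = 2 * int (j * (j - 1) div 2 + N * (N + 1) div 2)"
    unfolding of_nat_add distrib_left[of "2::int"] 2 3 4 by (simp add: m_def algebra_simps)
  thus ?thesis unfolding m_def by (metis mult_left_cancel of_nat_eq_iff zero_neq_numeral)
qed

lemma prod_lessThan_add:
  fixes f :: "nat \<Rightarrow> 'a::comm_monoid_mult"
  shows "(\<Prod>k<m+n. f k) = (\<Prod>k<m. f k) * (\<Prod>k<n. f (m + k))"
  by (induction n) (simp_all add: mult_ac)

text \<open>The q-binomial theorem with \<open>2 * N\<close> factors at
  \<open>x = - z / q ^ N\<close>. The upper \<open>N\<close> factors form the first product; the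
  lower \<open>N\<close>, read backwards, form the second up to the constant \<open>c\<close>, which
  also splits off from every summand.\<close>

lemma finite_jacobi_triple_product:
  assumes q: "q \<noteq> 0" and z: "z \<noteq> 0"
  shows "(\<Prod>k<N. 1 - z * q ^ k) * (\<Prod>k<N. 1 - q ^ Suc k / z) =
         (\<Sum>j\<le>2*N. qbinomial q (2*N) j * theta_term q z (int j - int N))"
proof -
  define x where "x = - z / q ^ N"
  define c where "c = (- z) ^ N / q ^ (N * (N + 1) div 2)"
  have c_prod: "(\<Prod>k<N. - z / q ^ Suc k) = c"
  proof -
    have "(\<Prod>k<N. q ^ Suc k) = q ^ (N * (N + 1) div 2)" for N
    proof (induction N)
      case (Suc N)
      have "Suc N * (Suc N + 1) div 2 = N * (N + 1) div 2 + Suc N"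
        using triangle_Suc[of "Suc N"] by simp
      thus ?case using Suc by (simp add: power_add)
    qed auto
    thus ?thesis by (simp only: prod_dividef prod_constant card_lessThan c_def)
  qed
  have c0: "c \<noteq> 0" using q z by (simp add: c_def)
  have "(\<Prod>k<N. 1 + x * q ^ k) = (\<Prod>k<N. 1 + x * q ^ (N - Suc k))"
    by (rule prod.nat_diff_reindex[symmetric])
  also have "\<dots> = (\<Prod>k<N. (- z / q ^ Suc k) * (1 - q ^ Suc k / z))"
  proof (rule prod.cong)
    fix k assume "k \<in> {..<N}"
    hence "q ^ N = q ^ (N - Suc k) * q ^ Suc k"
      by (simp only: power_add[symmetric]) simp
    hence "x * q ^ (N - Suc k) = - z / q ^ Suc k"
      using q by (simp add: x_def divide_simps)
    moreover have "1 + - z / w = (- z / w) * (1 - w / z)" if "w \<noteq> 0" for w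
      using that z by (simp add: field_simps)
    ultimately show "1 + x * q ^ (N - Suc k) = (- z / q ^ Suc k) * (1 - q ^ Suc k / z)"
      using q by (simp only: power_not_zero not_False_eq_True)
  qed simp
  also have "\<dots> = c * (\<Prod>k<N. 1 - q ^ Suc k / z)"
    by (simp only: prod.distrib c_prod)
  finally have lower: "(\<Prod>k<N. 1 + x * q ^ k) = c * (\<Prod>k<N. 1 - q ^ Suc k / z)" .
  have upper: "(\<Prod>k<N. 1 + x * q ^ (N + k)) = (\<Prod>k<N. 1 - z * q ^ k)"
    using q by (intro prod.cong) (auto simp: x_def power_add)
  have summand: "q ^ (j * (j - 1) div 2) * x ^ j = c * theta_term q z (int j - int N)" for j
  proof -
    have "q ^ (nat ((int j - int N) * (int j - int N - 1) div 2)) * q ^ (N * j)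
          = q ^ (j * (j - 1) div 2) * q ^ (N * (N + 1) div 2)"
      by (simp only: power_add[symmetric] triangle_shift)
    hence q_eq: "q ^ (j * (j - 1) div 2) / q ^ (N * j) =
             q ^ (nat ((int j - int N) * (int j - int N - 1) div 2)) / q ^ (N * (N + 1) div 2)"
      using q by (simp add: frac_eq_eq)
    have "(- 1) powi (int j - int N) * (-1) ^ N = ((-1) ^ j :: complex)"
      by (simp add: power_int_diff)
    moreover have "z powi (int j - int N) * z ^ N = z ^ j"
      using z by (simp add: power_int_diff)
    ultimately have zz: "(- z) ^ j = ((- 1) powi (int j - int N) * z powi (int j - int N)) * (- z) ^ N"
      by (simp add: power_minus[of z] mult_ac)
    have "x ^ j = (- z) ^ j / q ^ (N * j)"
      by (simp only: x_def power_divide power_mult)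
    hence "q ^ (j * (j - 1) div 2) * x ^ j = (- z) ^ j * (q ^ (j * (j - 1) div 2) / q ^ (N * j))"
      by simp
    also have "\<dots> = c * theta_term q z (int j - int N)"
      unfolding q_eq zz by (simp add: c_def theta_term_def)
    finally show ?thesis .
  qed
  have "c * ((\<Prod>k<N. 1 - z * q ^ k) * (\<Prod>k<N. 1 - q ^ Suc k / z)) = (\<Prod>k<2*N. 1 + x * q ^ k)"
    unfolding mult_2 prod_lessThan_add lower upper by (simp only: mult_ac)
  also have "\<dots> = (\<Sum>j\<le>2*N. qbinomial q (2*N) j * (q ^ (j * (j - 1) div 2) * x ^ j))"
    by (simp only: qbinomial_theorem mult.assoc)
  also have "\<dots> = c * (\<Sum>j\<le>2*N. qbinomial q (2*N) j * theta_term q z (int j - int N))"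
    unfolding summand by (simp add: sum_distrib_left mult_ac)
  finally show ?thesis
    using mult_left_cancel[OF c0] by blast
qed

lemma qfact_tendsto:
  assumes "norm (q::complex) < 1"
  shows "qfact q \<longlonglongrightarrow> qpoch_inf q q"
proof -
  have "(\<lambda>n. \<Prod>k\<le>n. 1 - q * q ^ k) \<longlonglongrightarrow> qpoch_inf q q"
    unfolding qpoch_inf_def by (rule convergent_prod_LIMSEQ[OF euler_convergent[OF assms]])
  hence "(\<lambda>n. qfact q (Suc n)) \<longlonglongrightarrow> qpoch_inf q q"
    by (simp only: qfact_def lessThan_Suc_atMost power_Suc)
  thus ?thesis by (rule LIMSEQ_imp_Suc)
qed

text \<open>After multiplication by \<open>qfact q N\<close>, the coefficients of the finite
  identity are uniformly bounded and each tends to 1, so dominated convergence applies. Keeping the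
  product side as a limit of finite products lets factors be compared one by one later.\<close>

theorem jacobi_triple_product:
  assumes q: "norm q < 1" "q \<noteq> 0" and z: "z \<noteq> 0"
  shows "(\<lambda>N. \<Prod>k<N. (1 - q ^ Suc k) * (1 - z * q ^ k) * (1 - q ^ Suc k / z))
           \<longlonglongrightarrow> jacobi_theta q z"
proof -
  define E where "E = qpoch_inf q q"
  have E0: "E \<noteq> 0" using euler_nonzero[OF q(1)] by (simp add: E_def)
  have lim: "qfact q \<longlonglongrightarrow> E" using qfact_tendsto[OF q(1)] by (simp add: E_def)
  have nz: "qfact q n \<noteq> 0" for n
    using euler_factor_nonzero[OF q(1)] by (simp add: qfact_def)
  obtain K where K: "\<And>n. norm (qfact q n) \<le> K"
    using convergent_imp_Bseq[OF convergentI[OF lim]] by (auto simp: Bseq_def)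
  obtain L where L: "\<And>n. norm (inverse (qfact q n)) \<le> L"
    using convergent_imp_Bseq[OF convergentI[OF tendsto_inverse[OF lim E0]]] by (auto simp: Bseq_def)
  have pos: "0 \<le> K" "0 \<le> L" using K[of 0] L[of 0] norm_ge_zero order_trans by blast+
  \<comment> \<open>Extension by 0 puts all the finite sums over the same index set.\<close>
  define a where "a N n = (if n \<in> {- int N..int N}
      then qfact q N * qbinomial q (2 * N) (nat (n + int N)) * theta_term q z n else 0)" for N n
  have quot: "qfact q N * qbinomial q (2 * N) (nat (n + int N)) =
      qfact q N * qfact q (2 * N) * inverse (qfact q (nat (n + int N)))
        * inverse (qfact q (nat (- n + int N)))"
    if "n \<in> {- int N..int N}" for N n
  proof -
    have le: "nat (n + int N) \<le> 2 * N" and e: "2 * N - nat (n + int N) = nat (- n + int N)"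
      using that by auto
    show ?thesis
      using qbinomial_qfact[OF le, of q] nz unfolding e by (simp add: field_simps)
  qed
  have sum_a: "(\<Sum>\<^sub>\<infinity>n. a N n) = (\<Prod>k<N. (1 - q ^ Suc k) * (1 - z * q ^ k) * (1 - q ^ Suc k / z))" for N
  proof -
    have "(\<Sum>\<^sub>\<infinity>n. a N n) = (\<Sum>\<^sub>\<infinity>n\<in>{- int N..int N}. a N n)"
      by (rule infsum_cong_neutral) (auto simp: a_def)
    also have "\<dots> = (\<Sum>n\<in>{- int N..int N}. a N n)"
      by simp
    also have "\<dots> = (\<Sum>j\<le>2*N. qfact q N * (qbinomial q (2*N) j * theta_term q z (int j - int N)))"
      by (rule sum.reindex_bij_witness[of _ "\<lambda>j. int j - int N" "\<lambda>n. nat (n + int N)"])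
        (auto simp: a_def mult.assoc)
    also have "\<dots> = qfact q N * ((\<Prod>k<N. 1 - z * q ^ k) * (\<Prod>k<N. 1 - q ^ Suc k / z))"
      by (simp only: finite_jacobi_triple_product[OF q(2) z] sum_distrib_left)
    also have "\<dots> = (\<Prod>k<N. (1 - q ^ Suc k) * (1 - z * q ^ k) * (1 - q ^ Suc k / z))"
      by (simp only: qfact_def prod.distrib mult.assoc)
    finally show ?thesis .
  qed
  have "(\<lambda>N. \<Sum>\<^sub>\<infinity>n. a N n) \<longlonglongrightarrow> (\<Sum>\<^sub>\<infinity>n. theta_term q z n)"
  proof (rule tannery_int)
    fix n :: int
    have cancel: "E * (E * (inverse E * (inverse E * t))) = t" for t
      using E0 by (simp add: field_simps)
    have shift: "filterlim (\<lambda>N. nat (m + int N)) at_top sequentially" for m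
      unfolding filterlim_at_top
    proof
      fix Z show "\<forall>\<^sub>F N in sequentially. Z \<le> nat (m + int N)"
        using eventually_ge_at_top[of "Z + nat (- m)"] by eventually_elim linarith
    qed
    have "filterlim (\<lambda>N::nat. 2 * N) at_top sequentially"
      by (intro filterlim_subseq) (auto simp: strict_mono_def)
    hence "(\<lambda>N. qfact q N * qfact q (2 * N) * inverse (qfact q (nat (n + int N)))
        * inverse (qfact q (nat (- n + int N))) * theta_term q z n)
        \<longlonglongrightarrow> E * E * inverse E * inverse E * theta_term q z n"
      by (intro tendsto_intros lim E0 filterlim_compose[OF lim] shift)
    hence "(\<lambda>N. qfact q N * qfact q (2 * N) * inverse (qfact q (nat (n + int N)))
        * inverse (qfact q (nat (- n + int N))) * theta_term q z n) \<longlonglongrightarrow> theta_term q z n"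
      using E0 by (simp only: mult.assoc right_inverse mult_1_right cancel)
    moreover have "\<forall>\<^sub>F N in sequentially. qfact q N * qfact q (2 * N) * inverse (qfact q (nat (n + int N)))
        * inverse (qfact q (nat (- n + int N))) * theta_term q z n = a N n"
      using eventually_ge_at_top[of "nat \<bar>n\<bar>"]
    proof eventually_elim
      case (elim N)
      hence "n \<in> {- int N..int N}" by auto
      thus ?case using quot by (simp only: a_def if_True)
    qed
    ultimately show "(\<lambda>N. a N n) \<longlonglongrightarrow> theta_term q z n"
      by (rule Lim_transform_eventually)
  next
    fix N n
    show "norm (a N n) \<le> K * K * L * L * norm (theta_term q z n)"
    proof (cases "n \<in> {- int N..int N}")
      case True
      have "norm (a N n) = norm (qfact q N) * norm (qfact q (2 * N)) *
          norm (inverse (qfact q (nat (n + int N)))) *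
          norm (inverse (qfact q (nat (- n + int N)))) * norm (theta_term q z n)"
        using True by (simp only: a_def if_True quot norm_mult)
      also have "\<dots> \<le> K * K * L * L * norm (theta_term q z n)"
        by (intro mult_mono K L mult_nonneg_nonneg pos norm_ge_zero order_refl)
      finally show ?thesis .
    next
      case False
      hence "a N n = 0" by (simp only: a_def if_False)
      thus ?thesis using pos by simp
    qed
  next
    show "(\<lambda>n. K * K * L * L * norm (theta_term q z n)) summable_on UNIV"
      unfolding norm_theta_term
      by (intro summable_on_cmult_right summable_theta_int) (use q z in auto)
  qed
  thus ?thesis by (simp only: sum_a jacobi_theta_def)
qed

section \<open>Dissection modulo 5\<close>

lemma theta_term_powi:
  assumes "q \<noteq> 0"
  shows "theta_term q z n = (-1) powi n * q powi (n * (n - 1) div 2) * z powi n"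
proof -
  have "0 \<le> n * (n - 1)"
    by (cases "n \<le> 0") (auto simp: mult_nonpos_nonpos)
  hence "q ^ nat (n * (n - 1) div 2) = q powi (n * (n - 1) div 2)"
    by (simp add: power_int_def)
  thus ?thesis by (simp only: theta_term_def)
qed

lemma theta_term_summable:
  assumes "norm q < 1" "q \<noteq> 0" "z \<noteq> 0"
  shows "theta_term q z summable_on UNIV"
proof (rule abs_summable_summable)
  show "(\<lambda>n. norm (theta_term q z n)) summable_on UNIV"
    unfolding norm_theta_term by (rule summable_theta_int) (use assms in auto)
qed

lemma infsum_int_mod5:
  fixes f :: "int \<Rightarrow> complex"
  assumes "f summable_on UNIV"
  shows "(\<Sum>\<^sub>\<infinity>n. f n) = (\<Sum>r\<in>{0,1,2,3,4}. \<Sum>\<^sub>\<infinity>m. f (5 * m + r))"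
proof -
  have bij: "bij_betw (\<lambda>(r, m). 5 * m + r) ({0,1,2,3,4} \<times> UNIV) (UNIV :: int set)"
  proof (rule bij_betw_byWitness[where f' = "\<lambda>n. (n mod 5, n div 5)"])
    have "n mod 5 \<in> {0,1,2,3,4}" for n :: int
      using pos_mod_bound[of 5 n] pos_mod_sign[of 5 n] by (simp del: pos_mod_bound pos_mod_sign) linarith
    thus "(\<lambda>n. (n mod 5, n div 5)) ` (UNIV :: int set) \<subseteq> {0,1,2,3,4} \<times> UNIV"
      by blast
  qed auto
  have s: "(\<lambda>x. f (case x of (r, m) \<Rightarrow> 5 * m + r)) summable_on {0,1,2,3,4} \<times> UNIV"
    using summable_on_reindex_bij_betw[OF bij, of f] assms by (simp only:)
  have "(\<Sum>\<^sub>\<infinity>n. f n) = (\<Sum>\<^sub>\<infinity>x\<in>{0,1,2,3,4} \<times> UNIV. f (case x of (r, m) \<Rightarrow> 5 * m + r))"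
    by (rule infsum_reindex_bij_betw[OF bij, symmetric])
  also have "\<dots> = (\<Sum>\<^sub>\<infinity>r\<in>{0,1,2,3,4}. \<Sum>\<^sub>\<infinity>m. f (5 * m + r))"
    using infsum_Sigma_banach[OF s] by simp
  also have "\<dots> = (\<Sum>r\<in>{0,1,2,3,4}. \<Sum>\<^sub>\<infinity>m. f (5 * m + r))"
    by (rule infsum_finite) simp
  finally show ?thesis .
qed

text \<open>The theta series in \<open>fun_A\<close> is the case \<open>c = 1\<close>, the one in \<open>fun_B\<close> the case \<open>c = 2\<close>.\<close>

definition theta5 :: "nat \<Rightarrow> complex \<Rightarrow> complex" where
  "theta5 c q = jacobi_theta (q ^ 5) (q ^ c)"

text \<open>The residue class 3 contributes nothing, because its terms are antisymmetric under
  \<open>m \<mapsto> -1 - m\<close>.\<close>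

lemma jacobi_theta_mod5_dissection:
  assumes q: "norm q < 1" "q \<noteq> 0" and z: "z ^ 5 = 1"
  shows "jacobi_theta q z = (1 - z) * theta5 2 (q ^ 5) + (z ^ 2 - z ^ 4) * q * theta5 1 (q ^ 5)"
proof -
  have z0: "z \<noteq> 0" using z by auto
  \<comment> \<open>These are the terms of \<open>theta5 c (q ^ 5)\<close>; every residue class
    except 3 is a reindexed multiple of them.\<close>
  define h where "h c m = theta_term ((q ^ 5) ^ 5) ((q ^ 5) ^ c) m" for c m
  define tri where "tri m = m * (m - 1) div 2" for m :: int
  \<comment> \<open>Exponent identities are checked after doubling, which removes the division in
    \<open>tri\<close>.\<close>
  have tri2: "2 * tri m = m * (m - 1)" for m
    unfolding tri_def by (rule dvd_mult_div_cancel) simp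
  have h: "h c m = (-1) powi m * q powi (25 * tri m + 5 * int c * m)" for c m
  proof -
    have "((q ^ 5) ^ 5) powi k = q powi (25 * k)" for k
      by (simp only: power_mult[symmetric] power_int_power) simp
    moreover have "((q ^ 5) ^ c) powi m = q powi (5 * int c * m)"
      by (simp only: power_mult[symmetric] power_int_power of_nat_mult of_nat_numeral)
    moreover have "(q ^ 5) ^ 5 \<noteq> 0" using q(2) by simp
    ultimately show ?thesis
      by (simp only: h_def theta_term_powi[OF \<open>(q ^ 5) ^ 5 \<noteq> 0\<close>] tri_def power_int_add[OF disjI1, OF q(2)] mult.assoc)
  qed
  have t: "theta_term q z n = (-1) powi n * q powi tri n * z powi n" for n
    by (simp only: theta_term_powi[OF q(2)] tri_def)
  have z5: "z powi (5 * m + int r) = z ^ r" for m r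
  proof -
    have "z powi (5 * m) = (z ^ 5) powi m"
      by (metis power_int_mult power_int_of_nat of_nat_numeral)
    thus ?thesis using z z0 by (simp add: power_int_add)
  qed
  have 0: "theta_term q z (5 * m + 0) = h 2 m" for m
  proof -
    have "2 * tri (5 * m) = 2 * (25 * tri m + 5 * int 2 * m)"
      unfolding distrib_left tri2 mult.left_commute[of 2 25] by (simp add: algebra_simps)
    hence "tri (5 * m) = 25 * tri m + 5 * int 2 * m" by simp
    thus ?thesis using z5[of m 0] by (simp only: t h) (simp add: power_int_minus_left)
  qed
  have 1: "theta_term q z (5 * m + 1) = - z * h 2 (- m)" for m
  proof -
    have "2 * tri (5 * m + 1) = 2 * (25 * tri (- m) + 5 * int 2 * - m)"
      unfolding distrib_left tri2 mult.left_commute[of 2 25] by (simp add: algebra_simps)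
    hence "tri (5 * m + 1) = 25 * tri (- m) + 5 * int 2 * - m" by simp
    moreover have "(-1) powi (5 * m + 1) = - ((-1) powi (- m) :: complex)"
      by (simp add: power_int_minus_left)
    ultimately show ?thesis using z5[of m 1] by (simp only: t h) simp
  qed
  have 2: "theta_term q z (5 * m + 2) = z ^ 2 * q * h 1 (- m)" for m
  proof -
    have "2 * tri (5 * m + 2) = 2 * (1 + (25 * tri (- m) + 5 * int 1 * - m))"
      unfolding distrib_left tri2 mult.left_commute[of 2 25] by (simp add: algebra_simps)
    hence "tri (5 * m + 2) = 1 + (25 * tri (- m) + 5 * int 1 * - m)" by simp
    moreover have "(-1) powi (5 * m + 2) = ((-1) powi (- m) :: complex)"
      by (simp add: power_int_minus_left)
    ultimately show ?thesis using z5[of m 2] q(2)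
      by (simp only: t h power_int_add[OF disjI1, OF q(2)]) (simp add: mult_ac)
  qed
  define g where "g m = (-1) powi m * q powi (25 * tri (m + 1) + 3)" for m
  have 3: "theta_term q z (5 * m + 3) = - (z ^ 3) * g m" for m
  proof -
    have "2 * tri (5 * m + 3) = 2 * (25 * tri (m + 1) + 3)"
      unfolding distrib_left tri2 mult.left_commute[of 2 25] by (simp add: algebra_simps)
    hence "tri (5 * m + 3) = 25 * tri (m + 1) + 3" by simp
    moreover have "(-1) powi (5 * m + 3) = - ((-1) powi m :: complex)"
      by (simp add: power_int_minus_left)
    ultimately show ?thesis using z5[of m 3] by (simp only: t g_def) simp
  qed
  have 4: "theta_term q z (5 * m + 4) = - (z ^ 4) * q * h 1 (m + 1)" for m
  proof -
    have "2 * tri (5 * m + 4) = 2 * (1 + (25 * tri (m + 1) + 5 * int 1 * (m + 1)))"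
      unfolding distrib_left tri2 mult.left_commute[of 2 25] by (simp add: algebra_simps)
    hence "tri (5 * m + 4) = 1 + (25 * tri (m + 1) + 5 * int 1 * (m + 1))" by simp
    moreover have "(-1) powi (5 * m + 4) = - ((-1) powi (m + 1) :: complex)"
      by (simp add: power_int_minus_left)
    ultimately show ?thesis using z5[of m 4] q(2)
      by (simp only: t h power_int_add[OF disjI1, OF q(2)]) (simp add: mult_ac)
  qed
  have neg: "(\<Sum>\<^sub>\<infinity>m. f (- m)) = (\<Sum>\<^sub>\<infinity>m. f m)" for f :: "int \<Rightarrow> complex"
    by (rule infsum_reindex_bij_betw) (auto intro!: bij_betw_byWitness[where f' = uminus])
  have shift: "(\<Sum>\<^sub>\<infinity>m. f (m + 1)) = (\<Sum>\<^sub>\<infinity>m. f m)" for f :: "int \<Rightarrow> complex"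
    by (rule infsum_reindex_bij_betw) (auto intro!: bij_betw_byWitness[where f' = "\<lambda>m. m - 1"])
  have "g (- (m + 1)) = - g m" for m
  proof -
    have "2 * tri (- (m + 1) + 1) = 2 * tri (m + 1)"
      unfolding tri2 by (simp add: algebra_simps)
    hence "tri (- (m + 1) + 1) = tri (m + 1)" by simp
    moreover have "(-1) powi (- (m + 1)) = - ((-1) powi m :: complex)"
      by (simp add: power_int_minus_left)
    ultimately show ?thesis by (simp only: g_def) simp
  qed
  hence "(\<Sum>\<^sub>\<infinity>m. g m) = - (\<Sum>\<^sub>\<infinity>m. g m)"
    using neg[of g] shift[of "\<lambda>m. g (- m)"] by (simp add: infsum_uminus)
  hence g0: "(\<Sum>\<^sub>\<infinity>m. g m) = 0" by simp
  have H: "(\<Sum>\<^sub>\<infinity>m. h c m) = theta5 c (q ^ 5)" for c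
    by (simp only: h_def theta5_def jacobi_theta_def)
  note S = 0[simplified] 1 2 3 4 infsum_cmult_right'
  have "jacobi_theta q z = (\<Sum>\<^sub>\<infinity>m. h 2 m) + (- z) * (\<Sum>\<^sub>\<infinity>m. h 2 (- m))
      + z ^ 2 * q * (\<Sum>\<^sub>\<infinity>m. h 1 (- m)) + (- (z ^ 3)) * (\<Sum>\<^sub>\<infinity>m. g m)
      + (- (z ^ 4)) * q * (\<Sum>\<^sub>\<infinity>m. h 1 (m + 1))"
    unfolding jacobi_theta_def infsum_int_mod5[OF theta_term_summable[OF q z0]]
    by (simp add: S infsum_uminus)
  also have "\<dots> = (1 - z) * theta5 2 (q ^ 5) + (z ^ 2 - z ^ 4) * q * theta5 1 (q ^ 5)"
    unfolding neg shift[of "h 1"] g0 H by (simp add: algebra_simps)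
  finally show ?thesis .
qed

section \<open>Product identities at fifth roots of unity\<close>

text \<open>The triple product contains \<open>1 - z\<close> at \<open>k = 0\<close>. Dividing by it
  moves all three factors to the exponent \<open>Suc k\<close>; the finite products then gain a
  factor \<open>1 - z * q ^ N\<close>, which tends to 1.\<close>

lemma tendsto_theta_quotient:
  assumes q: "norm q < 1" "q \<noteq> 0" and z: "z \<noteq> 0" "z \<noteq> 1"
  shows "(\<lambda>N. \<Prod>k<N. (1 - q ^ Suc k) * (1 - z * q ^ Suc k) * (1 - q ^ Suc k / z))
           \<longlonglongrightarrow> jacobi_theta q z / (1 - z)"
proof -
  define P where "P N = (\<Prod>k<N. (1 - q ^ Suc k) * (1 - z * q ^ k) * (1 - q ^ Suc k / z))" for N
  define T where "T N = (\<Prod>k<N. (1 - q ^ Suc k) * (1 - z * q ^ Suc k) * (1 - q ^ Suc k / z))" for N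
  have "T N = P N * (1 - z * q ^ N) / (1 - z)" for N
  proof -
    have e: "(1 - z) * (\<Prod>k<N. 1 - z * q ^ Suc k) = (\<Prod>k<N. 1 - z * q ^ k) * (1 - z * q ^ N)"
      using prod.lessThan_Suc_shift[of "\<lambda>k. 1 - z * q ^ k" N] by simp
    have "t * x * u = t * y * u * v / (1 - z)" if "(1 - z) * x = y * v" for t u v x y
    proof -
      have "x = y * v / (1 - z)" using that z by (simp add: field_simps)
      thus ?thesis by simp
    qed
    from this[OF e] show ?thesis unfolding T_def P_def prod.distrib .
  qed
  moreover have "(\<lambda>N. P N * (1 - z * q ^ N) / (1 - z)) \<longlonglongrightarrow> jacobi_theta q z * (1 - z * 0) / (1 - z)"
    unfolding P_def using z q
    by (intro tendsto_divide[OF tendsto_mult[OF jacobi_triple_product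
          tendsto_diff[OF tendsto_const tendsto_mult[OF tendsto_const LIMSEQ_power_zero]]] tendsto_const])
       auto
  ultimately show ?thesis by (simp add: T_def)
qed

section \<open>Fifth roots of unity: periods and norms\<close>

lemma cyclotomic5_relation:
  fixes w :: complex
  assumes "w ^ 5 = 1" "w \<noteq> 1"
  shows "1 + w + w ^ 2 + w ^ 3 + w ^ 4 = 0"
proof -
  have "(1 - w) * (1 + w + w ^ 2 + w ^ 3 + w ^ 4) = 1 - w ^ 5"
    by (simp add: algebra_simps eval_nat_numeral)
  thus ?thesis using assms by simp
qed

text \<open>The two quadratic Gaussian periods modulo 5, roots of X^2 + X - 1. Later products depend
  on \<open>w\<close> only through their sum and product, so the resulting coefficients are
  integers.\<close>

lemma golden_periods:
  fixes w :: complex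
  assumes w: "w ^ 5 = 1" "w \<noteq> 1"
  shows "(w + w ^ 4) + (w ^ 2 + w ^ 3) = -1" "(w + w ^ 4) * (w ^ 2 + w ^ 3) = -1"
proof -
  have "(w + w ^ 4) + (w ^ 2 + w ^ 3) = (1 + w + w ^ 2 + w ^ 3 + w ^ 4) - 1" by simp
  thus sum: "(w + w ^ 4) + (w ^ 2 + w ^ 3) = -1"
    by (simp only: cyclotomic5_relation[OF w]) simp
  have "(w + w ^ 4) * (w ^ 2 + w ^ 3) = ((w + w ^ 4) + (w ^ 2 + w ^ 3)) + (w ^ 5 - 1) * (w + w ^ 2)"
    by (simp add: algebra_simps eval_nat_numeral)
  thus "(w + w ^ 4) * (w ^ 2 + w ^ 3) = -1"
    by (simp only: sum w(1)) simp
qed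

lemma root_of_unity5_power_add:
  "w ^ 5 = 1 \<Longrightarrow> w ^ (5 * m + k) = (w ^ k :: complex)"
  by (simp only: power_add power_mult power_one mult_1_left)

lemma root_of_unity5_power_eq_1_iff:
  fixes w :: complex
  assumes w: "w ^ 5 = 1" "w \<noteq> 1"
  shows "w ^ k = 1 \<longleftrightarrow> 5 dvd k"
proof -
  have red: "w ^ k = w ^ (k mod 5)"
    using root_of_unity5_power_add[OF w(1), of "k div 5" "k mod 5"] by simp
  have "w ^ 2 \<noteq> 1"
  proof
    assume "w ^ 2 = 1"
    moreover have "w ^ 5 = (w ^ 2) ^ 2 * w" by (simp add: eval_nat_numeral)
    ultimately show False using w by simp
  qed
  moreover have "w ^ 3 \<noteq> 1"
  proof
    assume "w ^ 3 = 1"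
    moreover have "w ^ 5 * w = (w ^ 3) ^ 2" by (simp add: eval_nat_numeral)
    ultimately show False using w by simp
  qed
  moreover have "w ^ 4 \<noteq> 1"
  proof
    assume "w ^ 4 = 1"
    moreover have "w ^ 5 = w ^ 4 * w" by (simp add: eval_nat_numeral)
    ultimately show False using w by simp
  qed
  moreover have "k mod 5 \<in> {0,1,2,3,4}" by auto
  ultimately have "w ^ (k mod 5) = 1 \<longleftrightarrow> k mod 5 = 0"
    using w by (elim insertE emptyE) simp_all
  thus ?thesis
    by (simp only: red dvd_eq_mod_eq_0)
qed

text \<open>Pairing \<open>j\<close> with \<open>5 - j\<close> joins conjugate roots, so each pair
  can be expressed by the periods.\<close>

lemma prod_1_to_4: "(\<Prod>j\<in>{1,2,3,4::nat}. f j) = f 1 * f 4 * (f 2 * f 3 :: complex)"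
  by (simp add: mult_ac)

text \<open>The factor \<open>1 - x\<close> supplies the missing index \<open>j = 0\<close>. If 5
  divides \<open>k\<close>, all five factors coincide; otherwise \<open>w ^ k\<close> is again
  primitive and they factorise \<open>1 - x ^ 5\<close>.\<close>

lemma prod_roots_of_unity5:
  fixes w x :: complex
  assumes w: "w ^ 5 = 1" "w \<noteq> 1"
  shows "(\<Prod>j\<in>{1,2,3,4}. 1 - w ^ (j * k) * x) * (1 - x) = (if 5 dvd k then (1 - x) ^ 5 else 1 - x ^ 5)"
proof -
  define v where "v = w ^ k"
  have v5: "v ^ 5 = 1"
    unfolding v_def by (metis power_mult mult.commute w(1) power_one)
  have v: "w ^ (j * k) = v ^ j" for j
    unfolding v_def by (metis power_mult mult.commute)
  have e: "(\<Prod>j\<in>{1,2,3,4}. 1 - w ^ (j * k) * x) * (1 - x)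
      = (1 - v * x) * (1 - v ^ 4 * x) * ((1 - v ^ 2 * x) * (1 - v ^ 3 * x)) * (1 - x)"
    by (simp only: prod_1_to_4 v power_one_right)
  show ?thesis
  proof (cases "5 dvd k")
    case True
    hence "v = 1"
      using root_of_unity5_power_eq_1_iff[OF w] by (simp add: v_def)
    thus ?thesis using True unfolding e by (simp add: eval_nat_numeral)
  next
    case False
    hence "v \<noteq> 1"
      using root_of_unity5_power_eq_1_iff[OF w] by (simp add: v_def)
    define s t where "s = v + v ^ 4" and "t = v ^ 2 + v ^ 3"
    note st = golden_periods[OF v5 \<open>v \<noteq> 1\<close>, folded s_def t_def]
    have "(1 - v * x) * (1 - v ^ 4 * x) = 1 - s * x + v ^ 5 * x ^ 2"
      and "(1 - v ^ 2 * x) * (1 - v ^ 3 * x) = 1 - t * x + v ^ 5 * x ^ 2"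
      unfolding s_def t_def by (simp_all add: algebra_simps eval_nat_numeral)
    moreover have "(1 - s * x + x ^ 2) * (1 - t * x + x ^ 2)
        = 1 - (s + t) * x + (2 + s * t) * x ^ 2 - (s + t) * x ^ 3 + x ^ 4"
      by (simp add: algebra_simps eval_nat_numeral)
    moreover have "(1 - (-1) * x + (2 + (-1)) * x ^ 2 - (-1) * x ^ 3 + x ^ 4) * (1 - x) = 1 - x ^ 5"
      by (simp add: algebra_simps eval_nat_numeral)
    ultimately show ?thesis
      using False unfolding e by (simp only: v5 st mult_1_left if_False)
  qed
qed

text \<open>The factors are the conjugates of one linear form over the field of fifth roots of
  unity, so their product is a norm with integer coefficients. It is used with q \<theta>_A(q^5) for
  \<open>a\<close> and \<theta>_B(q^5) for \<open>b\<close>.\<close>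

lemma prod_linear_forms_A:
  fixes w a b :: complex
  assumes w: "w ^ 5 = 1" "w \<noteq> 1"
  shows "(\<Prod>j\<in>{1,2,3,4}. b + ((w ^ (1 * j)) ^ 2 + (w ^ (1 * j)) ^ 3) * (w ^ j * a))
         = b ^ 4 - 2 * a * b ^ 3 + 4 * a ^ 2 * b ^ 2 - 3 * a ^ 3 * b + a ^ 4"
proof -
  define s t where "s = w + w ^ 4" and "t = w ^ 2 + w ^ 3"
  note st = golden_periods[OF w, folded s_def t_def]
  have exps: "((w ^ (1 * j)) ^ 2 + (w ^ (1 * j)) ^ 3) * (w ^ j * a) = (w ^ (3 * j) + w ^ (4 * j)) * a" for j
  proof -
    have "3 * j = j * 2 + j" "4 * j = j * 3 + j" by simp_all
    thus ?thesis by (simp only: power_add power_mult mult_1 distrib_right mult.assoc)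
  qed
  have red: "w ^ (3 * 2) = w" "w ^ (4 * 2) = w ^ 3" "w ^ (3 * 3) = w ^ 4" "w ^ (4 * 3) = w ^ 2"
    "w ^ (3 * 4) = w ^ 2" "w ^ (4 * 4) = w"
    using root_of_unity5_power_add[OF w(1), of 1 1] root_of_unity5_power_add[OF w(1), of 1 3]
      root_of_unity5_power_add[OF w(1), of 1 4] root_of_unity5_power_add[OF w(1), of 2 2]
      root_of_unity5_power_add[OF w(1), of 3 1] by simp_all
  have "(b + (w ^ 3 + w ^ 4) * a) * (b + (w ^ 2 + w) * a)
      = b ^ 2 + (s + t) * (a * b) + (w ^ 5 * (2 + w) + w ^ 4) * a ^ 2"
    and "(b + (w + w ^ 3) * a) * (b + (w ^ 4 + w ^ 2) * a)
      = b ^ 2 + (s + t) * (a * b) + (w ^ 5 * (2 + w ^ 2) + w ^ 3) * a ^ 2"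
    unfolding s_def t_def by (simp_all add: algebra_simps eval_nat_numeral)
  moreover have "2 + w + w ^ 4 = 2 + s" "2 + w ^ 2 + w ^ 3 = 2 + t"
    by (simp_all add: s_def t_def)
  moreover have "(b ^ 2 + (-1) * (a * b) + (2 + s) * a ^ 2) * (b ^ 2 + (-1) * (a * b) + (2 + t) * a ^ 2)
      = b ^ 4 - 2 * a * b ^ 3 + (5 + (s + t)) * a ^ 2 * b ^ 2 - (4 + (s + t)) * a ^ 3 * b
        + (4 + 2 * (s + t) + s * t) * a ^ 4"
    by (simp add: algebra_simps eval_nat_numeral)
  moreover have "5 + (-1) = (4::complex)" "4 + (-1) = (3::complex)" "4 + 2 * (-1) + (-1) = (1::complex)"
    by simp_all
  ultimately show ?thesis
    unfolding prod_1_to_4 exps mult_1_right red by (simp only: w(1) st mult_1_left)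
qed

text \<open>The analogous norm for \<open>c = 2\<close>: since \<open>w ^ (5 * j)\<close> is 1, the
  linear form reduces to \<open>b + (1 + w ^ (2 * j)) * a\<close>.\<close>

lemma prod_linear_forms_B:
  fixes w a b :: complex
  assumes w: "w ^ 5 = 1" "w \<noteq> 1"
  shows "(\<Prod>j\<in>{1,2,3,4}. b + ((w ^ (2 * j)) ^ 2 + (w ^ (2 * j)) ^ 3) * (w ^ j * a))
         = b ^ 4 + 3 * a * b ^ 3 + 4 * a ^ 2 * b ^ 2 + 2 * a ^ 3 * b + a ^ 4"
proof -
  define s t where "s = w + w ^ 4" and "t = w ^ 2 + w ^ 3"
  note st = golden_periods[OF w, folded s_def t_def]
  have exps: "((w ^ (2 * j)) ^ 2 + (w ^ (2 * j)) ^ 3) * (w ^ j * a) = (1 + w ^ (2 * j)) * a" for j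
  proof -
    have "(w ^ (2 * j)) ^ 2 * w ^ j = w ^ (5 * j + 0)" "(w ^ (2 * j)) ^ 3 * w ^ j = w ^ (5 * j + 2 * j)"
      by (simp_all only: power_add[symmetric] power_mult[symmetric]) (simp_all add: algebra_simps)
    thus ?thesis
      by (simp only: root_of_unity5_power_add[OF w(1)] distrib_right mult.assoc[symmetric] power_0)
  qed
  have red: "w ^ (2 * 2) = w ^ 4" "w ^ (2 * 3) = w" "w ^ (2 * 4) = w ^ 3"
    using root_of_unity5_power_add[OF w(1), of 1 1] root_of_unity5_power_add[OF w(1), of 1 3] by simp_all
  have "(b + (1 + w ^ 2) * a) * (b + (1 + w ^ 3) * a)
      = b ^ 2 + (2 + t) * (a * b) + (1 + t + w ^ 5) * a ^ 2"
    and "(b + (1 + w ^ 4) * a) * (b + (1 + w) * a)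
      = b ^ 2 + (2 + s) * (a * b) + (1 + s + w ^ 5) * a ^ 2"
    unfolding s_def t_def by (simp_all add: algebra_simps eval_nat_numeral)
  moreover have "1 + t + 1 = 2 + t" "1 + s + 1 = 2 + s"
    by simp_all
  moreover have "(b ^ 2 + (2 + t) * (a * b) + (2 + t) * a ^ 2) * (b ^ 2 + (2 + s) * (a * b) + (2 + s) * a ^ 2)
      = b ^ 4 + (4 + (s + t)) * a * b ^ 3 + (8 + 3 * (s + t) + s * t) * a ^ 2 * b ^ 2
        + 2 * (4 + 2 * (s + t) + s * t) * a ^ 3 * b + (4 + 2 * (s + t) + s * t) * a ^ 4"
    by (simp add: algebra_simps eval_nat_numeral)
  moreover have "4 + (-1) = (3::complex)" "8 + 3 * (-1) + (-1) = (4::complex)"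
    "4 + 2 * (-1) + (-1) = (1::complex)"
    by simp_all
  ultimately show ?thesis
    unfolding prod_1_to_4 exps mult_1_right red by (simp only: w(1) st mult_1_left mult_1_right)
qed

section \<open>Fifth powers of the theta series\<close>

text \<open>For base \<open>q ^ 5\<close> and \<open>z = q ^ c\<close> the triple product has
  exponents 5k + 5, 5k + c and 5k + 5 - c, one of each per block of five. Trivial factors at the
  other exponents allow termwise comparison with the product for (q;q)_\<infinity>.\<close>

lemma theta5_tendsto:
  assumes q: "norm q < 1" "q \<noteq> 0" and c: "c \<in> {1, 2}"
  shows "(\<lambda>M. \<Prod>k<5*M. if Suc k mod 5 \<in> {0, c, 5 - c} then 1 - q ^ Suc k else 1)
           \<longlonglongrightarrow> theta5 c q"
proof -
  have "norm (q ^ 5) < 1"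
    using q by (simp add: norm_power power_less_one_iff)
  hence "(\<lambda>M. \<Prod>k<M. (1 - (q ^ 5) ^ Suc k) * (1 - q ^ c * (q ^ 5) ^ k) * (1 - (q ^ 5) ^ Suc k / q ^ c))
           \<longlonglongrightarrow> theta5 c q"
    unfolding theta5_def by (rule jacobi_triple_product) (use q in auto)
  moreover have "(\<Prod>k<M. (1 - (q ^ 5) ^ Suc k) * (1 - q ^ c * (q ^ 5) ^ k) * (1 - (q ^ 5) ^ Suc k / q ^ c))
      = (\<Prod>k<5*M. if Suc k mod 5 \<in> {0, c, 5 - c} then 1 - q ^ Suc k else 1)" for M
  proof (induction M)
    case (Suc M)
    define F where "F k = (if Suc k mod 5 \<in> {0, c, 5 - c} then 1 - q ^ Suc k else 1)" for k
    have "5 * Suc M = Suc (Suc (Suc (Suc (Suc (5 * M)))))" by simp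
    hence "(\<Prod>k<5 * Suc M. F k) = (\<Prod>k<5 * M. F k) * (F (5 * M) * F (5 * M + 1) * F (5 * M + 2)
        * F (5 * M + 3) * F (5 * M + 4))"
      by (simp only: prod.lessThan_Suc) (simp add: mult.assoc eval_nat_numeral)
    moreover have "F (5 * M) * F (5 * M + 1) * F (5 * M + 2) * F (5 * M + 3) * F (5 * M + 4)
        = (1 - (q ^ 5) ^ Suc M) * (1 - q ^ c * (q ^ 5) ^ M) * (1 - (q ^ 5) ^ Suc M / q ^ c)"
    proof -
      have m: "Suc (5 * M) mod 5 = 1" "Suc (5 * M + 1) mod 5 = 2" "Suc (5 * M + 2) mod 5 = 3"
        "Suc (5 * M + 3) mod 5 = 4" "Suc (5 * M + 4) mod 5 = 0"
        by presburger+
      define Q where "Q = q ^ (5 * M)"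
      have p: "(q ^ 5) ^ M = Q" "(q ^ 5) ^ Suc M = Q * q ^ 5"
        by (simp_all add: Q_def power_mult)
      have pw: "q ^ Suc (5 * M) = Q * q" "q ^ Suc (5 * M + 1) = Q * q ^ 2" "q ^ Suc (5 * M + 2) = Q * q ^ 3"
        "q ^ Suc (5 * M + 3) = Q * q ^ 4" "q ^ Suc (5 * M + 4) = Q * q ^ 5"
        by (simp_all add: Q_def power_add eval_nat_numeral mult_ac)
      have d: "Q * q ^ 5 / q ^ 1 = Q * q ^ 4" "Q * q ^ 5 / q ^ 2 = Q * q ^ 3"
        using q(2) by (simp_all add: eval_nat_numeral)
      consider "c = 1" | "c = 2" using c by blast
      thus ?thesis
      proof cases
        case 1
        show ?thesis unfolding F_def m p pw 1 d by (simp add: mult_ac)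
      next
        case 2
        show ?thesis unfolding F_def m p pw 2 d by (simp add: mult_ac)
      qed
    qed
    ultimately show ?case using Suc.IH unfolding F_def by (simp only: prod.lessThan_Suc)
  qed simp
  ultimately show ?thesis by simp
qed

text \<open>Both sides are limits along \<open>N = 5 M\<close> of finite products that already agree factor by factor.\<close>

theorem theta5_pow5:
  assumes q: "norm q < 1" "q \<noteq> 0" and c: "c \<in> {1, 2}" and w: "w ^ 5 = 1" "w \<noteq> 1"
  shows "(\<Prod>j\<in>{1,2,3,4}. theta5 2 (q ^ 5) + ((w ^ (c * j)) ^ 2 + (w ^ (c * j)) ^ 3) * (w ^ j * (q * theta5 1 (q ^ 5))))
           * qpoch_inf q q ^ 3 * theta5 c (q ^ 5)
         = theta5 c q ^ 5 * qpoch_inf (q ^ 5) (q ^ 5) ^ 3"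
proof -
  have w0: "w \<noteq> 0" using w by auto
  have nw: "norm w = 1"
    using w(1) by (metis norm_power norm_one power_eq_1_iff norm_ge_zero zero_neq_numeral)
  have q5: "norm (q ^ 5) < 1" "q ^ 5 \<noteq> 0"
    using q by (auto simp: norm_power power_less_one_iff)
  define I where "I k \<longleftrightarrow> Suc k mod 5 \<in> {0, c, 5 - c}" for k
  define T where "T j k = (1 - (w ^ j * q) ^ Suc k) * (1 - w ^ (c * j) * (w ^ j * q) ^ Suc k)
                          * (1 - (w ^ j * q) ^ Suc k / w ^ (c * j))" for j k
  define L where "L j = theta5 2 (q ^ 5) + ((w ^ (c * j)) ^ 2 + (w ^ (c * j)) ^ 3) * (w ^ j * (q * theta5 1 (q ^ 5)))" for j
  have T: "(\<lambda>N. \<Prod>k<N. T j k) \<longlonglongrightarrow> L j" if j: "j \<in> {1,2,3,4}" for j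
  proof -
    have qj: "norm (w ^ j * q) < 1" "w ^ j * q \<noteq> 0"
      using q w0 by (auto simp: norm_mult norm_power nw)
    have "\<not> 5 dvd c * j" using j c by auto
    hence z1: "w ^ (c * j) \<noteq> 1"
      using root_of_unity5_power_eq_1_iff[OF w] by simp
    \<comment> \<open>Replacing \<open>q\<close> by \<open>w ^ j * q\<close> leaves
      \<open>q ^ 5\<close> unchanged, so all four linear forms involve the same two theta
      values.\<close>
    have z5: "(w ^ (c * j)) ^ 5 = 1" and wj5: "(w ^ j * q) ^ 5 = q ^ 5"
      using w(1) by (metis power_mult mult.commute power_one) (metis power_mult mult.commute power_one power_mult_distrib mult_1 w(1))
    have "(1 - z) * b + (z ^ 2 - z ^ 4) * a = (1 - z) * (b + (z ^ 2 + z ^ 3) * a)" for z a b :: complex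
      by (simp add: algebra_simps eval_nat_numeral)
    hence "jacobi_theta (w ^ j * q) (w ^ (c * j)) = (1 - w ^ (c * j)) * L j"
      using jacobi_theta_mod5_dissection[OF qj z5] unfolding wj5 L_def by (simp only: mult.assoc)
    hence "jacobi_theta (w ^ j * q) (w ^ (c * j)) / (1 - w ^ (c * j)) = L j"
      using z1 by simp
    thus ?thesis
      using tendsto_theta_quotient[OF qj _ z1] w0 unfolding T_def by simp
  qed
  have termwise: "(\<Prod>j\<in>{1,2,3,4}. T j k) * (1 - q ^ Suc k) ^ 3 * (if I k then 1 - (q ^ 5) ^ Suc k else 1)
      = (if I k then 1 - q ^ Suc k else 1) ^ 5 * (1 - (q ^ 5) ^ Suc k) ^ 3" for k
  proof -
    define n where "n = Suc k"
    define x where "x = q ^ n"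
    have x5: "(q ^ 5) ^ n = x ^ 5" by (simp add: x_def flip: power_mult) (simp add: mult.commute)
    \<comment> \<open>The exponent \<open>n + 5 - c\<close> represents n - c modulo 5 and stays
      natural for \<open>n < c\<close>.\<close>
    have T_eq: "T j k = (1 - w ^ (j * n) * x) * (1 - w ^ (j * (n + c)) * x) * (1 - w ^ (j * (n + 5 - c)) * x)" for j
    proof -
      have "(w ^ j * q) ^ n = w ^ (j * n) * x"
        by (simp add: x_def power_mult_distrib power_mult)
      moreover have "w ^ (c * j) * (w ^ (j * n) * x) = w ^ (j * (n + c)) * x"
        by (simp add: power_add algebra_simps)
      moreover have "w ^ (j * (n + 5 - c)) * w ^ (c * j) = w ^ (j * n)"
      proof -
        have "j * (n + 5 - c) + c * j = j * (n + 5 - c + c)" by (simp add: algebra_simps)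
        also have "\<dots> = j * n + 5 * j" using c by (auto simp: algebra_simps)
        finally have "w ^ (j * (n + 5 - c)) * w ^ (c * j) = w ^ (j * n) * (w ^ 5) ^ j"
          by (simp only: power_add[symmetric] power_mult[symmetric])
        thus ?thesis using w by simp
      qed
      hence "w ^ (j * n) * x / w ^ (c * j) = w ^ (j * (n + 5 - c)) * x"
        using w0 by (simp add: field_simps)
      ultimately show ?thesis by (simp only: T_def n_def)
    qed
    define g where "g i = (if 5 dvd i then (1 - x) ^ 5 else 1 - x ^ 5)" for i :: nat
    define f where "f i = (\<Prod>j\<in>{1,2,3,4}. 1 - w ^ (j * i) * x)" for i
    have fg: "f i * (1 - x) = g i" for i
      unfolding f_def g_def by (rule prod_roots_of_unity5[OF w])
    have "(\<Prod>j\<in>{1,2,3,4}. T j k) = f n * f (n + c) * f (n + 5 - c)"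
      by (simp only: T_eq prod.distrib f_def)
    hence "(\<Prod>j\<in>{1,2,3,4}. T j k) * (1 - x) ^ 3 = g n * g (n + c) * g (n + 5 - c)"
      unfolding fg[symmetric] by (simp add: power3_eq_cube)
    \<comment> \<open>At most one of n, n + c and n - c is divisible by 5, and one of them is
      exactly when \<open>I k\<close> holds.\<close>
    moreover have "g n * g (n + c) * g (n + 5 - c) * (if I k then 1 - x ^ 5 else 1)
        = (if I k then 1 - x else 1) ^ 5 * (1 - x ^ 5) ^ 3"
    proof -
      define r where "r = n mod 5"
      have I: "I k \<longleftrightarrow> r \<in> {0, c, 5 - c}"
        by (simp only: I_def r_def n_def)
      have "g (n + i) = g (r + i)" for i
        by (simp add: g_def r_def dvd_eq_mod_eq_0 mod_add_left_eq)
      moreover have "g n = g r"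
        by (simp add: g_def r_def dvd_eq_mod_eq_0)
      moreover have "n + 5 - c = n + (5 - c)" using c by auto
      ultimately have g: "g n * g (n + c) * g (n + 5 - c) = g r * g (r + c) * g (r + (5 - c))"
        by simp
      have "r \<in> {0,1,2,3,4}"
        unfolding r_def by auto
      thus ?thesis
        unfolding I g using c by (elim insertE emptyE) (auto simp: g_def power3_eq_cube dest: dvd_imp_le)
    qed
    ultimately show ?thesis by (simp only: n_def[symmetric] x_def[symmetric] x5)
  qed
  have sub: "filterlim (\<lambda>M::nat. 5 * M) at_top sequentially"
    by (intro filterlim_subseq) (auto simp: strict_mono_def)
  have E: "(\<lambda>M. \<Prod>k<5*M. 1 - r ^ Suc k) \<longlonglongrightarrow> qpoch_inf r r" if "norm r < 1" for r :: complex
    using filterlim_compose[OF qfact_tendsto[OF that] sub] by (simp only: qfact_def)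
  have theta: "(\<lambda>M. \<Prod>k<5*M. if I k then 1 - r ^ Suc k else 1) \<longlonglongrightarrow> theta5 c r"
    if "norm r < 1" "r \<noteq> 0" for r
    unfolding I_def by (rule theta5_tendsto[OF that c])
  have "(\<lambda>M. \<Prod>j\<in>{1,2,3,4}. \<Prod>k<5*M. T j k) \<longlonglongrightarrow> (\<Prod>j\<in>{1,2,3,4}. L j)"
    by (rule tendsto_prod) (rule filterlim_compose[OF T sub])
  note lhs = tendsto_mult[OF tendsto_mult[OF this tendsto_power[OF E[OF q(1)], of 3]] theta[OF q5]]
  note rhs = tendsto_mult[OF tendsto_power[OF theta[OF q], of 5] tendsto_power[OF E[OF q5(1)], of 3]]
  have "(\<Prod>j\<in>{1,2,3,4}. \<Prod>k<5*M. T j k) * (\<Prod>k<5*M. 1 - q ^ Suc k) ^ 3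
            * (\<Prod>k<5*M. if I k then 1 - (q ^ 5) ^ Suc k else 1)
      = (\<Prod>k<5*M. if I k then 1 - q ^ Suc k else 1) ^ 5 * (\<Prod>k<5*M. 1 - (q ^ 5) ^ Suc k) ^ 3" for M
  proof -
    have swap: "(\<Prod>j\<in>{1,2,3,4}. \<Prod>k<5*M. T j k) = (\<Prod>k<5*M. \<Prod>j\<in>{1,2,3,4}. T j k)"
      by (rule prod.swap)
    have "(\<Prod>k<5*M. (\<Prod>j\<in>{1,2,3,4}. T j k) * (1 - q ^ Suc k) ^ 3 * (if I k then 1 - (q ^ 5) ^ Suc k else 1))
        = (\<Prod>k<5*M. (if I k then 1 - q ^ Suc k else 1) ^ 5 * (1 - (q ^ 5) ^ Suc k) ^ 3)"
      by (rule prod.cong[OF refl termwise])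
    thus ?thesis
      unfolding swap by (simp only: prod.distrib prod_power_distrib)
  qed
  hence "(\<Prod>j\<in>{1,2,3,4}. L j) * qpoch_inf q q ^ 3 * theta5 c (q ^ 5)
      = theta5 c q ^ 5 * qpoch_inf (q ^ 5) (q ^ 5) ^ 3"
    using rhs by (intro LIMSEQ_unique[OF lhs]) (simp only:)
  thus ?thesis by (simp only: L_def)
qed

section \<open>The functions A and B\<close>

text \<open>The right-hand side has no negative exponents, so it is holomorphic at \<open>q = 0\<close>; the left-hand
  side agrees there because \<open>0 powi n = 0\<close> for \<open>n \<noteq> 0\<close>.\<close>

lemma theta_term_power:
  assumes "c \<in> {1, 2}"
  shows "theta_term (q ^ 5) (q ^ c) n = (-1) powi n * q ^ nat (5 * (n * (n - 1) div 2) + int c * n)"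
proof -
  define t where "t = n * (n - 1) div 2"
  have t2: "2 * t = n * (n - 1)"
    unfolding t_def by (rule dvd_mult_div_cancel) simp
  \<comment> \<open>For \<open>c\<close> equal to 1 or 2 and \<open>n \<noteq> 0\<close> the second
    factor has the sign of \<open>n\<close>, so the exponent is positive.\<close>
  have e2: "2 * (5 * t + int c * n) = n * (5 * n - 5 + 2 * int c)"
    using t2 by (simp add: algebra_simps)
  have pos: "5 * t + int c * n > 0" if "n \<noteq> 0"
  proof -
    have "n * (5 * n - 5 + 2 * int c) > 0"
    proof (cases "n > 0")
      case True
      hence "5 * n - 5 + 2 * int c > 0" using assms by auto
      with True show ?thesis by (rule mult_pos_pos)
    next
      case False
      hence "n < 0" "5 * n - 5 + 2 * int c < 0" using assms that by auto
      thus ?thesis by (rule mult_neg_neg)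
    qed
    thus ?thesis using e2 by simp
  qed
  show ?thesis
  proof (cases "q = 0")
    case True
    thus ?thesis
      using pos assms unfolding t_def[symmetric] theta_term_def
      by (cases "n = 0") (auto simp: t_def)
  next
    case False
    have "0 \<le> 5 * t + int c * n" using pos by (cases "n = 0") (auto simp: t_def)
    hence "q ^ nat (5 * t + int c * n) = q powi (5 * t + int c * n)"
      by (simp add: power_int_def)
    also have "\<dots> = q powi (5 * t) * q powi (int c * n)"
      by (rule power_int_add) (use False in simp)
    also have "q powi (5 * t) = (q ^ 5) powi t"
      by (simp add: power_int_power)
    also have "q powi (int c * n) = (q ^ c) powi n"
      by (simp add: power_int_power)
    finally show ?thesis
      using False by (subst theta_term_powi) (simp_all add: t_def)
  qed
qed

text \<open>The M-test on closed discs around \<open>x\<close>: their points have modulus at most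
  \<open>r < 1\<close>, so the terms are dominated by those at the real point \<open>r\<close>,
  which are summable.\<close>

lemma theta5_holomorphic:
  assumes c: "c \<in> {1, 2}"
  shows "theta5 c holomorphic_on ball 0 1"
proof (rule holomorphic_uniform_sequence)
  define e where "e n = nat (5 * (n * (n - 1) div 2) + int c * n)" for n
  define f where "f k q = (-1) powi int_decode k * q ^ e (int_decode k)" for k and q :: complex
  show "(\<lambda>q. \<Sum>k<N. f k q) holomorphic_on ball 0 1" for N
    unfolding f_def by (intro holomorphic_intros)
  fix x :: complex assume x: "x \<in> ball 0 1"
  define d where "d = (1 - norm x) / 2"
  define r where "r = norm x + d"
  have d: "d > 0" and "r < 1" using x by (auto simp: d_def r_def field_simps)
  moreover have "0 < r" unfolding r_def by (rule add_nonneg_pos) (use d in auto)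
  ultimately have r: "0 < r" "r < 1" by auto
  have sub: "norm y \<le> r" if "y \<in> cball x d" for y
    using that norm_triangle_ineq[of x "y - x"] by (auto simp: r_def dist_norm norm_minus_commute)
  have "norm (theta_term (of_real r ^ 5) (of_real r ^ c) n) = r ^ e n" for n
    unfolding theta_term_power[OF c] e_def[symmetric] using r
    by (simp add: norm_mult norm_power norm_power_int)
  moreover have "(\<lambda>n. norm (theta_term (of_real r ^ 5) (of_real r ^ c) n)) summable_on UNIV"
    unfolding norm_theta_term
    by (rule summable_theta_int) (use r in \<open>auto simp: norm_power power_less_one_iff\<close>)
  ultimately have M: "(\<lambda>n. r ^ e n) summable_on UNIV" by simp
  have bound: "norm (f k q) \<le> r ^ e (int_decode k)" if "norm q \<le> r" for k q
    using that by (simp add: f_def norm_mult norm_power norm_power_int power_mono)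
  have "theta5 c q = (\<Sum>k. f k q)" if "norm q \<le> r" for q
  proof -
    have "norm (theta_term (q ^ 5) (q ^ c) n) \<le> r ^ e n" for n
      using that unfolding theta_term_power[OF c] e_def[symmetric]
      by (simp add: norm_mult norm_power norm_power_int power_mono)
    from infsum_int_eq_suminf[OF M this] show ?thesis
      unfolding theta5_def jacobi_theta_def theta_term_power[OF c] e_def[symmetric] f_def .
  qed
  hence eq: "theta5 c q = (\<Sum>k. f k q)" if "q \<in> cball x d" for q
    using sub[OF that] by blast
  have "uniform_limit (cball x d) (\<lambda>N q. \<Sum>k<N. f k q) (\<lambda>q. \<Sum>k. f k q) sequentially"
    by (rule Weierstrass_m_test[OF bound[OF sub] summable_int_decode[OF M]])
  hence "uniform_limit (cball x d) (\<lambda>N q. \<Sum>k<N. f k q) (theta5 c) sequentially"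
    by (subst uniform_limit_cong'[where g = "\<lambda>N q. \<Sum>k<N. f k q" and i = "\<lambda>q. \<Sum>k. f k q"]) (auto simp: eq)
  moreover have "cball x d \<subseteq> ball 0 1" using sub r by fastforce
  ultimately show "\<exists>d>0. cball x d \<subseteq> ball 0 1 \<and>
      uniform_limit (cball x d) (\<lambda>N q. \<Sum>k<N. f k q) (theta5 c) sequentially"
    using d by blast
qed auto

section \<open>From functions of q to functions of \<tau>\<close>

lemma qpow_add: "qpow (r + s) \<tau> = qpow r \<tau> * qpow s \<tau>"
  by (simp add: qpow_def algebra_simps flip: exp_add)

lemma qpow_power: "qpow r \<tau> ^ n = qpow (real n * r) \<tau>"
  by (simp add: qpow_def mult_ac flip: exp_of_nat_mult)

lemma qpow_nonzero: "qpow r \<tau> \<noteq> 0"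
  by (simp add: qpow_def)

lemma qpow_powi: "qpow r \<tau> powi n = qpow (of_int n * r) \<tau>"
  by (simp add: qpow_def exp_power_int mult_ac)

lemma qpow_5: "qpow r (5 * \<tau>) = qpow (5 * r) \<tau>"
  by (simp add: qpow_def mult_ac)

lemma theta5_nome:
  "theta5 c (nome \<tau>) = (\<Sum>\<^sub>\<infinity>n::int. (-1) powi n * qpow (of_int (5 * n^2 + (2 * int c - 5) * n) / 2) \<tau>)"
  unfolding theta5_def jacobi_theta_def
proof (rule infsum_cong)
  fix n :: int
  define T where "T = n * (n - 1) div 2"
  have "2 * T = n * (n - 1)"
    unfolding T_def by (rule dvd_mult_div_cancel) simp
  hence "real_of_int (2 * T) = real_of_int (n * (n - 1))"
    by (simp only:)
  hence t: "real_of_int T = of_int (n * (n - 1)) / 2"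
    by simp
  have "nome \<tau> ^ 5 \<noteq> 0" by (simp add: qpow_nonzero)
  hence "theta_term (nome \<tau> ^ 5) (nome \<tau> ^ c) n
      = (-1) powi n * (qpow (of_int T * 5) \<tau> * qpow (of_int n * real c) \<tau>)"
    by (subst theta_term_powi) (simp_all add: qpow_power qpow_powi T_def)
  also have "qpow (of_int T * 5) \<tau> * qpow (of_int n * real c) \<tau>
      = qpow (of_int (5 * n^2 + (2 * int c - 5) * n) / 2) \<tau>"
    unfolding qpow_add[symmetric] t by (rule arg_cong[where f = "\<lambda>r. qpow r \<tau>"])
      (simp add: field_simps power2_eq_square)
  finally show "theta_term (nome \<tau> ^ 5) (nome \<tau> ^ c) n
      = (-1) powi n * qpow (of_int (5 * n^2 + (2 * int c - 5) * n) / 2) \<tau>" .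
qed

lemma fun_A_eq: "fun_A \<tau> = qpow (1/5) \<tau> * euler_pow (nome \<tau>) * theta5 1 (nome \<tau>)"
  by (simp add: fun_A_def theta5_nome)

lemma fun_B_eq: "fun_B \<tau> = euler_pow (nome \<tau>) * theta5 2 (nome \<tau>)"
  by (simp add: fun_B_def theta5_nome)

lemma euler_pow_unit_branch: "is_unit_branch (\<lambda>q. qpoch_inf q q) (-3) 5 euler_pow"
  unfolding euler_pow_def by (rule unit_branch_euler) simp

lemma euler_pow_power5:
  assumes "norm q < 1"
  shows "euler_pow q ^ 5 * qpoch_inf q q ^ 3 = 1"
proof -
  have "euler_pow q ^ 5 = qpoch_inf q q powi (-3)"
    using euler_pow_unit_branch assms by (simp add: is_unit_branch_def)
  also have "\<dots> = inverse (qpoch_inf q q ^ 3)"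
    by (simp add: power_int_minus)
  finally show ?thesis using euler_nonzero[OF assms] by simp
qed

lemma ex_primitive_root_of_unity5: "\<exists>w::complex. w ^ 5 = 1 \<and> w \<noteq> 1"
proof (rule ccontr)
  assume "\<not> ?thesis"
  hence "{w::complex. w ^ 5 = 1} \<subseteq> {1}" by auto
  hence "card {w::complex. w ^ 5 = 1} \<le> card {1::complex}"
    by (intro card_mono) auto
  thus False using card_roots_unity_eq[of 5] by simp
qed

text \<open>Multiplying \<open>theta5_pow5\<close> by fifth powers of \<open>euler_pow\<close> at q
  and q^5 cancels the cubes of the infinite products. At 5 \<tau> the prefactor q^(1/5) of
  \<open>fun_A\<close> becomes q, the very factor accompanying
  \<open>theta5 1 (q ^ 5)\<close>.\<close>

lemma fun_A_B_power5:
  assumes "Im \<tau> > 0"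
  defines "a \<equiv> fun_A (5 * \<tau>)" and "b \<equiv> fun_B (5 * \<tau>)"
  shows "fun_A \<tau> ^ 5 = a * (b ^ 4 - 2 * a * b ^ 3 + 4 * a ^ 2 * b ^ 2 - 3 * a ^ 3 * b + a ^ 4)" (is ?A)
    and "fun_B \<tau> ^ 5 = b * (b ^ 4 + 3 * a * b ^ 3 + 4 * a ^ 2 * b ^ 2 + 2 * a ^ 3 * b + a ^ 4)" (is ?B)
proof -
  obtain w :: complex where w: "w ^ 5 = 1" "w \<noteq> 1"
    using ex_primitive_root_of_unity5 by blast
  define x where "x = nome \<tau>"
  have x: "norm x < 1" "x \<noteq> 0"
    using norm_nome_less_1[OF assms(1)] by (auto simp: x_def qpow_nonzero)
  have x5: "norm (x ^ 5) < 1"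
    using x by (simp add: norm_power power_less_one_iff)
  have nome5: "nome (5 * \<tau>) = x ^ 5" and root: "qpow (1/5) (5 * \<tau>) = x" "qpow (1/5) \<tau> ^ 5 = x"
    by (simp_all add: x_def qpow_5 qpow_power)
  define e where "e = euler_pow x"
  define h where "h = euler_pow (x ^ 5)"
  define s where "s = theta5 1 (x ^ 5)"
  define t where "t = theta5 2 (x ^ 5)"
  have a: "a = h * (x * s)" and b: "b = h * t"
    by (simp_all add: a_def b_def fun_A_eq fun_B_eq nome5 root h_def s_def t_def)
  have key: "Q * h ^ 5 * u = v ^ 5 * e ^ 5"
    if "Q * qpoch_inf x x ^ 3 * u = v ^ 5 * qpoch_inf (x ^ 5) (x ^ 5) ^ 3" for Q u v
  proof -
    have "Q * h ^ 5 * u = (Q * qpoch_inf x x ^ 3 * u) * e ^ 5 * h ^ 5"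
      using euler_pow_power5[OF x(1)] by (simp add: e_def mult_ac)
    also have "\<dots> = v ^ 5 * e ^ 5 * (h ^ 5 * qpoch_inf (x ^ 5) (x ^ 5) ^ 3)"
      unfolding that by (simp only: mult_ac)
    finally show ?thesis using euler_pow_power5[OF x5] by (simp add: h_def)
  qed
  have "fun_A \<tau> ^ 5 = x * (theta5 1 x ^ 5 * e ^ 5)"
    by (simp add: fun_A_eq power_mult_distrib root e_def mult_ac flip: x_def)
  also have "theta5 1 x ^ 5 * e ^ 5
      = (t ^ 4 - 2 * (x * s) * t ^ 3 + 4 * (x * s) ^ 2 * t ^ 2 - 3 * (x * s) ^ 3 * t + (x * s) ^ 4) * h ^ 5 * s"
    using theta5_pow5[OF x _ w, of 1] unfolding prod_linear_forms_A[OF w] s_def t_def by (intro key[symmetric]) simp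
  also have "x * \<dots> = a * (b ^ 4 - 2 * a * b ^ 3 + 4 * a ^ 2 * b ^ 2 - 3 * a ^ 3 * b + a ^ 4)"
    unfolding a b by (simp add: algebra_simps eval_nat_numeral)
  finally show ?A .
  have "fun_B \<tau> ^ 5 = theta5 2 x ^ 5 * e ^ 5"
    by (simp add: fun_B_eq power_mult_distrib e_def mult_ac flip: x_def)
  also have "\<dots> = (t ^ 4 + 3 * (x * s) * t ^ 3 + 4 * (x * s) ^ 2 * t ^ 2 + 2 * (x * s) ^ 3 * t + (x * s) ^ 4) * h ^ 5 * t"
    using theta5_pow5[OF x _ w, of 2] unfolding prod_linear_forms_B[OF w] s_def t_def by (intro key[symmetric]) simp
  also have "\<dots> = b * (b ^ 4 + 3 * a * b ^ 3 + 4 * a ^ 2 * b ^ 2 + 2 * a ^ 3 * b + a ^ 4)"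
    unfolding a b by (simp add: algebra_simps eval_nat_numeral)
  finally show ?B .
qed

section \<open>Homogeneous forms and the main theorem\<close>

text \<open>A form in two variables is encoded by its dehomogenisation. The degree \<open>n\<close>
  is a separate parameter because \<open>p\<close> may have lower degree, as \<open>poly_B\<close>
  does in a form of degree 5.\<close>

definition hom_eval :: "nat \<Rightarrow> int poly \<Rightarrow> complex \<Rightarrow> complex \<Rightarrow> complex" where
  "hom_eval n p x y = (\<Sum>k\<le>n. of_int (coeff p k) * x ^ k * y ^ (n - k))"

text \<open>For \<open>y \<noteq> 0\<close> a form is a power of \<open>y\<close> times a polynomial
  in \<open>x / y\<close>, which is multiplicative. For \<open>y = 0\<close> only the coefficient at
  the formal degree survives, and these multiply under the degree bounds.\<close>

lemma hom_eval_mult: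
  assumes p: "degree p \<le> m" and q: "degree q \<le> n"
  shows "hom_eval (m + n) (p * q) x y = hom_eval m p x y * hom_eval n q x y"
proof (cases "y = 0")
  case True
  have top: "hom_eval k r x 0 = of_int (coeff r k) * x ^ k" for k r
  proof -
    have "hom_eval k r x 0 = (\<Sum>i\<le>k. if i = k then of_int (coeff r k) * x ^ k else 0)"
      unfolding hom_eval_def by (intro sum.cong) auto
    thus ?thesis by simp
  qed
  have "coeff (p * q) (m + n) = (\<Sum>i\<le>m + n. if i = m then coeff p m * coeff q n else 0)"
    unfolding coeff_mult
  proof (rule sum.cong)
    fix i assume "i \<in> {..m + n}"
    show "coeff p i * coeff q (m + n - i) = (if i = m then coeff p m * coeff q n else 0)"
    proof (cases i m rule: linorder_cases)
      case less
      hence "degree q < m + n - i" using q by simp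
      thus ?thesis using less by (simp add: coeff_eq_0)
    next
      case greater
      hence "degree p < i" using p by simp
      thus ?thesis using greater by (simp add: coeff_eq_0)
    qed simp
  qed simp
  hence "coeff (p * q) (m + n) = coeff p m * coeff q n" by simp
  thus ?thesis unfolding True top by (simp add: power_add mult_ac)
next
  case False
  have dehom: "hom_eval k r x y = y ^ k * (\<Sum>i\<le>k. of_int (coeff r i) * (x / y) ^ i)" for k r
    unfolding hom_eval_def sum_distrib_left
  proof (rule sum.cong)
    fix i assume "i \<in> {..k}"
    hence "y ^ k = y ^ (k - i) * y ^ i" by (simp flip: power_add)
    thus "of_int (coeff r i) * x ^ i * y ^ (k - i) = y ^ k * (of_int (coeff r i) * (x / y) ^ i)"
      using False by (simp add: power_divide)
  qed simp
  have "(\<Sum>i\<le>m. of_int (coeff p i) * (x / y) ^ i) * (\<Sum>i\<le>n. of_int (coeff q i) * (x / y) ^ i)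
      = (\<Sum>r\<le>m + n. (\<Sum>k\<le>r. of_int (coeff p k) * of_int (coeff q (r - k))) * (x / y) ^ r)"
    by (rule polynomial_product) (use p q in \<open>auto intro: coeff_eq_0\<close>)
  also have "\<dots> = (\<Sum>r\<le>m + n. of_int (coeff (p * q) r) * (x / y) ^ r)"
    by (simp add: coeff_mult)
  finally show ?thesis
    unfolding dehom by (simp add: power_add mult_ac)
qed

lemma degree_power_le_mult:
  "degree p \<le> n \<Longrightarrow> degree (p ^ k) \<le> n * k" for p :: "'a::comm_semiring_1 poly"
  using degree_power_le[of p k] by (meson le_trans mult_le_mono1)

lemma hom_eval_power:
  assumes "degree p \<le> n"
  shows "hom_eval (n * k) (p ^ k) x y = hom_eval n p x y ^ k"
proof (induction k)
  case 0
  show ?case by (simp add: hom_eval_def)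
next
  case (Suc k)
  show ?case
    using hom_eval_mult[OF assms degree_power_le_mult[OF assms], of k x y] Suc by simp
qed

text \<open>The coefficients are those of the two forms of degree 5 that express \<open>fun_A \<tau> ^ 5\<close> and
  \<open>fun_B \<tau> ^ 5\<close> in terms of \<open>fun_A (5 * \<tau>)\<close> and \<open>fun_B (5 * \<tau>)\<close>.\<close>

definition poly_A :: "int poly" where "poly_A = [:0, 1, -2, 4, -3, 1:]"
definition poly_B :: "int poly" where "poly_B = [:1, 3, 4, 2, 1:]"

text \<open>Column \<open>k\<close> expresses A^(5k) B^(5(d-k)) at \<tau> as a form of degree 5d in
  the values of A and B at 5 \<tau>.\<close>

definition mat_B :: "nat \<Rightarrow> int mat" where
  "mat_B d = Matrix.mat (5 * d + 1) (d + 1) (\<lambda>(i, k). coeff (poly_A ^ k * poly_B ^ (d - k)) i)"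

lemma fun_A_power5_hom_eval:
  "Im \<tau> > 0 \<Longrightarrow> fun_A \<tau> ^ 5 = hom_eval 5 poly_A (fun_A (5 * \<tau>)) (fun_B (5 * \<tau>))"
  unfolding fun_A_B_power5(1) hom_eval_def poly_A_def
  by (simp add: eval_nat_numeral algebra_simps)

lemma fun_B_power5_hom_eval:
  "Im \<tau> > 0 \<Longrightarrow> fun_B \<tau> ^ 5 = hom_eval 5 poly_B (fun_A (5 * \<tau>)) (fun_B (5 * \<tau>))"
  unfolding fun_A_B_power5(2) hom_eval_def poly_B_def
  by (simp add: eval_nat_numeral algebra_simps)

text \<open>Each monomial is replaced by its form at 5 \<tau>; interchanging the two sums leaves the
  matrix-vector product as coefficients. Passing from \<tau> to \<tau>/5 then yields the formula for
  \<pi>.\<close>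

lemma form_quintupling:
  fixes a b :: "complex vec"
  assumes a: "a \<in> carrier_vec (d + 1)" and b: "b = map_mat of_int (mat_B d) *\<^sub>v a"
    and \<tau>: "Im \<tau> > 0"
  shows "(\<Sum>k\<le>d. vec_index a k * fun_A \<tau> ^ (5 * k) * fun_B \<tau> ^ (5 * (d - k)))
       = (\<Sum>i\<le>5 * d. vec_index b i * fun_A (5 * \<tau>) ^ i * fun_B (5 * \<tau>) ^ (5 * d - i))"
proof -
  define x where "x = fun_A (5 * \<tau>)"
  define y where "y = fun_B (5 * \<tau>)"
  have deg: "degree poly_A \<le> 5" "degree poly_B \<le> 5"
    by (simp_all add: poly_A_def poly_B_def)
  have "fun_A \<tau> ^ (5 * k) * fun_B \<tau> ^ (5 * (d - k))
      = (\<Sum>i\<le>5 * d. of_int (coeff (poly_A ^ k * poly_B ^ (d - k)) i) * x ^ i * y ^ (5 * d - i))"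
    if "k \<le> d" for k
  proof -
    have "fun_A \<tau> ^ (5 * k) * fun_B \<tau> ^ (5 * (d - k))
        = hom_eval (5 * k) (poly_A ^ k) x y * hom_eval (5 * (d - k)) (poly_B ^ (d - k)) x y"
      unfolding power_mult hom_eval_power[OF deg(1)] hom_eval_power[OF deg(2)]
        fun_A_power5_hom_eval[OF \<tau>] fun_B_power5_hom_eval[OF \<tau>] x_def y_def ..
    also have "\<dots> = hom_eval (5 * k + 5 * (d - k)) (poly_A ^ k * poly_B ^ (d - k)) x y"
      by (rule hom_eval_mult[symmetric]) (rule degree_power_le_mult[OF deg(1)] degree_power_le_mult[OF deg(2)])+
    also have "5 * k + 5 * (d - k) = 5 * d" using that by simp
    finally show ?thesis by (simp only: hom_eval_def)
  qed
  hence "(\<Sum>k\<le>d. vec_index a k * fun_A \<tau> ^ (5 * k) * fun_B \<tau> ^ (5 * (d - k)))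
      = (\<Sum>k\<le>d. \<Sum>i\<le>5 * d. of_int (coeff (poly_A ^ k * poly_B ^ (d - k)) i) * vec_index a k
          * x ^ i * y ^ (5 * d - i))"
    by (intro sum.cong refl) (simp add: mult.assoc sum_distrib_left mult.left_commute)
  also have "\<dots> = (\<Sum>i\<le>5 * d. (\<Sum>k\<le>d. of_int (coeff (poly_A ^ k * poly_B ^ (d - k)) i) * vec_index a k)
          * x ^ i * y ^ (5 * d - i))"
    by (subst sum.swap) (simp add: sum_distrib_right)
  also have "\<dots> = (\<Sum>i\<le>5 * d. vec_index b i * x ^ i * y ^ (5 * d - i))"
  proof (intro sum.cong refl)
    fix i assume i: "i \<in> {..5 * d}"
    have "vec_index b i = (\<Sum>k\<in>{0..<d + 1}. of_int (coeff (poly_A ^ k * poly_B ^ (d - k)) i) * vec_index a k)"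
      using i a unfolding b mat_B_def by (auto simp: scalar_prod_def intro!: sum.cong)
    also have "{0..<d + 1} = {..d}" by auto
    finally show "(\<Sum>k\<le>d. of_int (coeff (poly_A ^ k * poly_B ^ (d - k)) i) * vec_index a k)
          * x ^ i * y ^ (5 * d - i) = vec_index b i * x ^ i * y ^ (5 * d - i)"
      by simp
  qed
  finally show ?thesis by (simp only: x_def y_def)
qed

section \<open>Assembling the q-expansions\<close>

lemma holomorphic_has_q_expansion:
  assumes "h holomorphic_on ball 0 1" and "\<And>\<tau>. Im \<tau> > 0 \<Longrightarrow> f \<tau> = h (nome \<tau>)"
  shows "\<exists>F. has_q_expansion f F"
proof -
  have "has_q_expansion f (Abs_fps (\<lambda>n. (deriv ^^ n) h 0 / fact n))"
    unfolding has_q_expansion_def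
    using holomorphic_power_series[OF assms(1)] norm_nome_less_1 assms(2) by auto
  thus ?thesis by blast
qed

text \<open>Each residue class gives a series with gaps, obtained by reindexing along N j + m;
  adding the \<open>N\<close> series fills the gaps. This builds the expansion of the whole form
  from five separate ones.\<close>

lemma sums_interleave:
  fixes s :: "nat \<Rightarrow> nat \<Rightarrow> complex"
  assumes N: "N > 0" and S: "\<And>m. m < N \<Longrightarrow> (\<lambda>j. s m j * (x ^ N) ^ j) sums S m"
  shows "(\<lambda>n. s (n mod N) (n div N) * x ^ n) sums (\<Sum>m<N. x ^ m * S m)"
proof -
  define f where "f m n = (if n mod N = m then s m (n div N) * x ^ n else 0)" for m n
  have "f m sums (x ^ m * S m)" if m: "m < N" for m
  proof -
    have "f m (N * j + m) = x ^ m * (s m j * (x ^ N) ^ j)" for j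
      using m by (simp add: f_def power_add power_mult)
    hence "(\<lambda>j. f m (N * j + m)) sums (x ^ m * S m)"
      using sums_mult[OF S[OF m], of "x ^ m"] by simp
    moreover have "strict_mono (\<lambda>j. N * j + m)"
      using N by (auto simp: strict_mono_def)
    moreover have "f m n = 0" if "n \<notin> range (\<lambda>j. N * j + m)" for n
    proof -
      have "n mod N \<noteq> m"
      proof
        assume "n mod N = m"
        hence "n = N * (n div N) + m" by (metis mult_div_mod_eq)
        with that show False by blast
      qed
      thus ?thesis by (simp add: f_def)
    qed
    ultimately show ?thesis
      using sums_mono_reindex[of "\<lambda>j. N * j + m" "f m"] by blast
  qed
  hence "(\<lambda>n. \<Sum>m<N. f m n) sums (\<Sum>m<N. x ^ m * S m)"
    by (intro sums_sum) auto
  moreover have "(\<Sum>m<N. f m n) = s (n mod N) (n div N) * x ^ n" for n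
    using N by (simp add: f_def)
  ultimately show ?thesis by simp
qed

theorem theorem1p2:
  fixes d :: nat
  shows "\<exists>M :: int mat. M \<in> carrier_mat (5 * d + 1) (d + 1) \<and>
    (\<forall>a b :: complex vec. a \<in> carrier_vec (d + 1) \<longrightarrow> b = map_mat of_int M *\<^sub>v a \<longrightarrow>
      (\<exists>F. has_q_expansion
             (\<lambda>\<tau>. \<Sum>k\<le>d. vec_index a k * fun_A \<tau> ^ (5 * k) * fun_B \<tau> ^ (5 * (d - k))) F \<and>
        (\<forall>\<tau>. Im \<tau> > 0 \<longrightarrow>
           op_pi F \<tau> = (\<Sum>k\<le>5 * d. vec_index b k * fun_A \<tau> ^ k * fun_B \<tau> ^ (5 * d - k))) \<and>
        (\<forall>m\<le>4. has_q_expansion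
             (\<lambda>\<tau>. qpow (- real m / 5) \<tau> *
                (\<Sum>k | int k \<le> int d - principal_char5 m.
                   vec_index b (5 * k + m) * fun_A \<tau> ^ (5 * k + m)
                     * fun_B \<tau> ^ (5 * d - 5 * k - m)))
             (op_Omega5 m F))))"
proof (intro exI[of _ "mat_B d"] conjI allI impI)
  show "mat_B d \<in> carrier_mat (5 * d + 1) (d + 1)"
    by (simp add: mat_B_def)
next
  fix a b :: "complex vec"
  assume a: "a \<in> carrier_vec (d + 1)" and b: "b = map_mat of_int (mat_B d) *\<^sub>v a"
  define f where "f \<tau> = (\<Sum>k\<le>d. vec_index a k * fun_A \<tau> ^ (5 * k) * fun_B \<tau> ^ (5 * (d - k)))" for \<tau>
  define K where "K m = {k. int k \<le> int d - principal_char5 m}" for m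
  define G where "G \<tau> i = vec_index b i * fun_A \<tau> ^ i * fun_B \<tau> ^ (5 * d - i)" for \<tau> i
  define R where "R m \<tau> = qpow (- real m / 5) \<tau> * (\<Sum>k\<in>K m. G \<tau> (5 * k + m))" for m \<tau>
  \<comment> \<open>For \<open>m > 0\<close> the index \<open>k = d\<close> would exceed
    \<open>5 * d\<close>, and the character removes it. Comparing integers makes the set empty for
    \<open>d = 0\<close>.\<close>
  have K: "K m = {k. 5 * k + m \<le> 5 * d}" if "m < 5" for m
  proof -
    have "5 dvd m \<longleftrightarrow> m = 0" using that by (auto dest: dvd_imp_le)
    thus ?thesis using that by (cases "m = 0") (auto simp: K_def principal_char5_def)
  qed
  have f: "f \<tau> = (\<Sum>i\<le>5 * d. G (5 * \<tau>) i)" if "Im \<tau> > 0" for \<tau>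
    unfolding f_def G_def by (rule form_quintupling[OF a b that])
  have "\<exists>F. has_q_expansion (R m) F" if m: "m < 5" for m
  proof (rule holomorphic_has_q_expansion)
    \<comment> \<open>The power A^(5k+m) contributes q^(k+m/5), and the prefactor q^(-m/5) of
      \<open>R m\<close> removes the fractional part, leaving a function holomorphic in q.\<close>
    define h where "h q = (\<Sum>k\<in>K m. vec_index b (5 * k + m) * q ^ k * euler_pow q ^ (5 * d)
        * theta5 1 q ^ (5 * k + m) * theta5 2 q ^ (5 * d - (5 * k + m)))" for q
    have "euler_pow holomorphic_on ball 0 1"
      using euler_pow_unit_branch by (simp add: is_unit_branch_def)
    thus "h holomorphic_on ball 0 1"
      unfolding h_def by (intro holomorphic_intros theta5_holomorphic) auto
    fix \<tau> :: complex assume "Im \<tau> > 0"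
    have "qpow (- real m / 5) \<tau> * G \<tau> (5 * k + m) = vec_index b (5 * k + m) * nome \<tau> ^ k * euler_pow (nome \<tau>) ^ (5 * d)
        * theta5 1 (nome \<tau>) ^ (5 * k + m) * theta5 2 (nome \<tau>) ^ (5 * d - (5 * k + m))"
      if "k \<in> K m" for k
    proof -
      have "5 * k + m \<le> 5 * d" using that K[OF m] by auto
      hence e: "euler_pow (nome \<tau>) ^ (5 * d)
          = euler_pow (nome \<tau>) ^ (5 * k + m) * euler_pow (nome \<tau>) ^ (5 * d - (5 * k + m))"
        by (simp flip: power_add)
      have rearrange: "p * (v * (r * u * x) * (w * y)) = v * (p * r) * (u * w) * x * y"
        for p v r u x w y :: complex
        by (simp only: mult_ac)
      have "qpow (- real m / 5) \<tau> * qpow (1/5) \<tau> ^ (5 * k + m) = nome \<tau> ^ k"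
        by (simp add: qpow_power add_divide_distrib flip: qpow_add)
      thus ?thesis
        unfolding G_def fun_A_eq fun_B_eq power_mult_distrib e by (simp only: rearrange)
    qed
    thus "R m \<tau> = h (nome \<tau>)"
      unfolding R_def h_def sum_distrib_left by (intro sum.cong) auto
  qed
  then obtain s where s: "\<And>m. m < 5 \<Longrightarrow> has_q_expansion (R m) (s m)"
    by metis
  \<comment> \<open>Interleaving the five expansions makes \<open>op_Omega5 m F = s m\<close>
    immediate.\<close>
  define F where "F = Abs_fps (\<lambda>n. fps_nth (s (n mod 5)) (n div 5))"
  have split: "(\<Sum>i\<le>5 * d. g i) = (\<Sum>m<5. \<Sum>k\<in>K m. g (5 * k + m))" for g :: "nat \<Rightarrow> complex"
  proof -
    have fin: "finite (K m)" if "m < 5" for m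
      by (rule finite_subset[of _ "{..d}"]) (auto simp: K[OF that])
    have "(\<Sum>m<5. \<Sum>k\<in>K m. g (5 * k + m)) = (\<Sum>(m, k)\<in>Sigma {..<5} K. g (5 * k + m))"
      by (rule sum.Sigma) (auto intro: fin)
    also have "\<dots> = (\<Sum>i\<le>5 * d. g i)"
      by (rule sum.reindex_bij_witness[of _ "\<lambda>i. (i mod 5, i div 5)" "\<lambda>(m, k). 5 * k + m"])
        (auto simp: K)
    finally show ?thesis ..
  qed
  have F: "has_q_expansion f F"
    unfolding has_q_expansion_def
  proof (intro allI impI)
    fix \<tau> :: complex assume \<tau>: "Im \<tau> > 0"
    define x where "x = nome \<tau>"
    have x5: "nome (5 * \<tau>) = x ^ 5" by (simp add: x_def qpow_5 qpow_power)
    have "(\<lambda>j. fps_nth (s m) j * (x ^ 5) ^ j) sums R m (5 * \<tau>)" if "m < 5" for m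
      using s[OF that] \<tau> by (simp add: has_q_expansion_def x5[symmetric])
    hence "(\<lambda>n. fps_nth F n * x ^ n) sums (\<Sum>m<5. x ^ m * R m (5 * \<tau>))"
      unfolding F_def fps_nth_Abs_fps by (intro sums_interleave) auto
    also have "(\<Sum>m<5. x ^ m * R m (5 * \<tau>)) = (\<Sum>m<5. \<Sum>k\<in>K m. G (5 * \<tau>) (5 * k + m))"
    proof (intro sum.cong refl)
      fix m
      \<comment> \<open>At 5 \<tau> the prefactor of \<open>R m\<close> is q^(-m), which the
        interleaving factor \<open>x ^ m\<close> cancels.\<close>
      have "x ^ m * qpow (- real m / 5) (5 * \<tau>) = 1"
        by (simp add: x_def qpow_5 qpow_power flip: qpow_add) (simp add: qpow_def)
      thus "x ^ m * R m (5 * \<tau>) = (\<Sum>k\<in>K m. G (5 * \<tau>) (5 * k + m))"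
        by (simp add: R_def flip: mult.assoc)
    qed
    also have "\<dots> = f \<tau>"
      by (simp only: f[OF \<tau>] split)
    finally show "(\<lambda>n. fps_nth F n * nome \<tau> ^ n) sums f \<tau>"
      by (simp only: x_def)
  qed
  \<comment> \<open>Replacing q^n by q^(n/5) amounts to evaluating the expansion of \<open>f\<close>
    at \<open>\<tau> / 5\<close>, where \<open>f\<close> is a form in the values at \<tau>.\<close>
  have pi: "op_pi F \<tau> = (\<Sum>i\<le>5 * d. G \<tau> i)" if \<tau>: "Im \<tau> > 0" for \<tau>
  proof -
    have "qpow (real n / 5) \<tau> = nome (\<tau> / 5) ^ n" for n
      using qpow_5[of "real n / 5" "\<tau> / 5"] by (simp add: qpow_power)
    moreover have "Im (\<tau> / 5) > 0" using \<tau> by simp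
    ultimately have "op_pi F \<tau> = f (\<tau> / 5)"
      using F unfolding op_pi_def has_q_expansion_def by (simp add: sums_iff)
    also have "\<dots> = (\<Sum>i\<le>5 * d. G \<tau> i)"
      using f[of "\<tau> / 5"] \<tau> by simp
    finally show ?thesis .
  qed
  have Omega: "has_q_expansion (R m) (op_Omega5 m F)" if "m \<le> 4" for m
  proof -
    have "op_Omega5 m F = s m"
      using that by (simp add: op_Omega5_def F_def fps_eq_iff)
    thus ?thesis using s[of m] that by simp
  qed
  have R_eq: "R m = (\<lambda>\<tau>. qpow (- real m / 5) \<tau> *
      (\<Sum>k | int k \<le> int d - principal_char5 m. vec_index b (5 * k + m) *
        fun_A \<tau> ^ (5 * k + m) * fun_B \<tau> ^ (5 * d - 5 * k - m)))" for m
    by (simp only: fun_eq_iff R_def K_def G_def diff_diff_left simp_thms)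
  show "\<exists>F. has_q_expansion
             (\<lambda>\<tau>. \<Sum>k\<le>d. vec_index a k * fun_A \<tau> ^ (5 * k) * fun_B \<tau> ^ (5 * (d - k))) F \<and>
        (\<forall>\<tau>. Im \<tau> > 0 \<longrightarrow>
           op_pi F \<tau> = (\<Sum>k\<le>5 * d. vec_index b k * fun_A \<tau> ^ k * fun_B \<tau> ^ (5 * d - k))) \<and>
        (\<forall>m\<le>4. has_q_expansion
             (\<lambda>\<tau>. qpow (- real m / 5) \<tau> *
                (\<Sum>k | int k \<le> int d - principal_char5 m.
                   vec_index b (5 * k + m) * fun_A \<tau> ^ (5 * k + m)
                     * fun_B \<tau> ^ (5 * d - 5 * k - m)))
             (op_Omega5 m F))"
    unfolding R_eq[symmetric] f_def[abs_def, symmetric]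
    by (intro exI[of _ F] conjI allI impI F Omega) (simp_all only: pi G_def)
qed

end
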